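(* Let $(\mathbf{x},\mathbf{x}^+)$ be a pair of random variables with joint density $p(\mathbf{x},\mathbf{x}^+)$. Let $q(\mathbf{r}\mid\mathbf{x},\mathbf{x}^+)$ be any conditional density of an auxiliary latent variable $\mathbf{r}$ given $(\mathbf{x},\mathbf{x}^+)$ (the variational distribution), and let $p(\mathbf{r}\mid\mathbf{x})$ be any conditional density of $\mathbf{r}$ given $\mathbf{x}$ (the conditional prior). Define the joint density $\tilde p(\mathbf{x},\mathbf{x}^+,\mathbf{r}) := p(\mathbf{x},\mathbf{x}^+)\,q(\mathbf{r}\mid\mathbf{x},\mathbf{x}^+)$. Then $$-I_{\tilde p}(\mathbf{r};\mathbf{x}^+\mid\mathbf{x}) \;\geq\; -\mathcal{L}_{\mathrm{Reg}},\qquad \mathcal{L}_{\mathrm{Reg}} := \mathbb{E}_{p(\mathbf{x},\mathbf{x}^+)}\left[D_{\mathrm{KL}}\left(q(\mathbf{r}\mid\mathbf{x},\mathbf{x}^+)\,\|\,p(\mathbf{r}\mid\mathbf{x})\right)\right].$$ Consequently, for every real-valued similarity function $s(\mathbf{x},\mathbf{x}^+,\mathbf{r})$, every $\tau>0$ and every integer $K\geq 1$, $$I(\mathbf{x};\mathbf{x}^+)\;\geq\; -\mathcal{L}_{\mathrm{InfoNCE}}-\mathcal{L}_{\mathrm{Reg}},$$ where $$-\mathcal{L}_{\mathrm{InfoNCE}} := \mathbb{E}\left[\frac1K\sum_{i=1}^K \log\frac{e^{s(\mathbf{x}^{(i)},{\mathbf{x}^+}^{(i)},\mathbf{r}^{(i)})/\tau}}{\frac1K\sum_{j=1}^K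 e^{s(\mathbf{x}^{(i)},{\mathbf{x}^+}^{(j)},\mathbf{r}^{(i)})/\tau}}\right]$$ and the expectation is over $K$ triples $(\mathbf{x}^{(i)},{\mathbf{x}^+}^{(i)},\mathbf{r}^{(i)})$, $i=1,\dots,K$, drawn i.i.d. from $\tilde p$.
   Context: $I(\cdot\,;\cdot)$ denotes mutual information and $I_{\tilde p}(\cdot\,;\cdot\mid\cdot)$ conditional mutual information computed under the joint law $\tilde p$; the $(\mathbf{x},\mathbf{x}^+)$-marginal of $\tilde p$ is $p(\mathbf{x},\mathbf{x}^+)$. $D_{\mathrm{KL}}$ is the Kullback–Leibler divergence. The conditional prior $p(\mathbf{r}\mid\mathbf{x})$ need not coincide with the conditional $\tilde p(\mathbf{r}\mid\mathbf{x})=\int p(\mathbf{x}^+\mid\mathbf{x})\,q(\mathbf{r}\mid\mathbf{x},\mathbf{x}^+)\,d\mathbf{x}^+$ induced by $\tilde p$. All densities, and the stated expectations and information quantities, are assumed to be well defined. *)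

theory Defs
  imports "HOL-Probability.Probability"
begin

text \<open>
  Information quantities are measured in nats and take values in \<open>[0, \<infinity>]\<close>.  The library's
  \<^const>\<open>KL_divergence\<close> is a Bochner integral, hence \<open>0\<close> when the divergence is infinite.
  For probability measures \<open>P\<close>, \<open>Q\<close> the negative part of \<open>log (dP/dQ)\<close> is always
  \<open>P\<close>-integrable, so non-integrability means that the divergence is \<open>\<infinity>\<close>; and a finite divergence
  is nonnegative, so the truncation by \<^const>\<open>ennreal\<close> loses nothing.
  The argument order is that of \<open>D(P \<parallel> Q)\<close>, the opposite of the library's.
\<close>

definition KL :: "'a measure \<Rightarrow> 'a measure \<Rightarrow> ennreal" where
  "KL P Q =
    (if absolutely_continuous Q P \<and> integrable P (entropy_density (exp 1) Q P)
     then ennreal (KL_divergence (exp 1) Q P) else \<infinity>)"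

definition mutual_info ::
  "'w measure \<Rightarrow> 'a measure \<Rightarrow> 'b measure \<Rightarrow> ('w \<Rightarrow> 'a) \<Rightarrow> ('w \<Rightarrow> 'b) \<Rightarrow> ennreal" where
  "mutual_info M S T X Y =
    KL (distr M (S \<Otimes>\<^sub>M T) (\<lambda>\<omega>. (X \<omega>, Y \<omega>))) (distr M S X \<Otimes>\<^sub>M distr M T Y)"

lemma (in prob_space) mutual_info_eq_mutual_information:
  assumes "mutual_info M S T X Y \<noteq> \<infinity>"
  shows "mutual_info M S T X Y = ennreal (mutual_information (exp 1) S T X Y)"
  using assms
  by (auto simp: mutual_info_def mutual_information_def KL_def split: if_splits)

text \<open>
  \<open>k a\<close> is the density with respect to \<open>N\<close> of a conditional law given the value \<open>a\<close> of a
  variable with law \<open>P\<close>.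
\<close>

definition conditional_density :: "'a measure \<Rightarrow> 'b measure \<Rightarrow> ('a \<Rightarrow> 'b \<Rightarrow> ennreal) \<Rightarrow> bool" where
  "conditional_density P N k \<longleftrightarrow>
    (\<lambda>(a, b). k a b) \<in> borel_measurable (P \<Otimes>\<^sub>M N) \<and> (AE a in P. (\<integral>\<^sup>+ b. k a b \<partial>N) = 1)"

text \<open>
  For a joint density \<open>f\<close> of \<open>((x, y), r)\<close>: \<open>I(r; y | x)\<close> is the average over \<open>x\<close> of the mutual
  information of \<open>r\<close> and \<open>y\<close> under their joint conditional law given \<open>x\<close>.
  The library's \<open>conditional_mutual_information\<close> is the real difference
  \<open>I(r; (y, x)) - I(r; x)\<close>, which is meaningless when \<open>I(r; x)\<close> is infinite even though
  \<open>I(r; y | x)\<close> may then be finite.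
  Where the marginal density vanishes or is infinite, \<open>cond_law\<close> is arbitrary; such \<open>x\<close> form a
  null set for the law of \<open>x\<close>.
\<close>

definition marginal_density ::
  "'y measure \<Rightarrow> 'r measure \<Rightarrow> (('x \<times> 'y) \<times> 'r \<Rightarrow> ennreal) \<Rightarrow> 'x \<Rightarrow> ennreal" where
  "marginal_density MY MR f x = (\<integral>\<^sup>+ (y, r). f ((x, y), r) \<partial>(MY \<Otimes>\<^sub>M MR))"

definition cond_law ::
  "'y measure \<Rightarrow> 'r measure \<Rightarrow> (('x \<times> 'y) \<times> 'r \<Rightarrow> ennreal) \<Rightarrow> 'x \<Rightarrow> ('y \<times> 'r) measure" where
  "cond_law MY MR f x =
    density (MY \<Otimes>\<^sub>M MR) (\<lambda>(y, r). f ((x, y), r) / marginal_density MY MR f x)"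

definition cond_mutual_info ::
  "'x measure \<Rightarrow> 'y measure \<Rightarrow> 'r measure \<Rightarrow> (('x \<times> 'y) \<times> 'r \<Rightarrow> ennreal) \<Rightarrow> ennreal" where
  "cond_mutual_info MX MY MR f =
    (\<integral>\<^sup>+ x. mutual_info (cond_law MY MR f x) MR MY snd fst
      \<partial>density MX (marginal_density MY MR f))"

definition joint_density ::
  "('x \<times> 'y \<Rightarrow> ennreal) \<Rightarrow> ('x \<times> 'y \<Rightarrow> 'r \<Rightarrow> ennreal) \<Rightarrow> ('x \<times> 'y) \<times> 'r \<Rightarrow> ennreal" where
  "joint_density p q = (\<lambda>(z, r). p z * q z r)"

definition reg_loss ::
  "('x \<times> 'y) measure \<Rightarrow> 'r measure \<Rightarrow> ('x \<times> 'y \<Rightarrow> 'r \<Rightarrow> ennreal) \<Rightarrow> ('x \<Rightarrow> 'r \<Rightarrow> ennreal) \<Rightarrow> ennreal"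
where
  "reg_loss P MR q prior =
    (\<integral>\<^sup>+ (x, y). KL (density MR (q (x, y))) (density MR (prior x)) \<partial>P)"

text \<open>
  Expectation with values in the extended reals, meaningful unless both parts are infinite.
  The InfoNCE integrand below is at most \<open>ln K\<close>, so its positive part is always integrable.
\<close>

definition ext_expectation :: "'a measure \<Rightarrow> ('a \<Rightarrow> real) \<Rightarrow> ereal" where
  "ext_expectation M g =
    enn2ereal (\<integral>\<^sup>+ w. ennreal (g w) \<partial>M) - enn2ereal (\<integral>\<^sup>+ w. ennreal (- g w) \<partial>M)"

definition infoNCE_loss ::
  "(('x \<times> 'y) \<times> 'r) measure \<Rightarrow> ('x \<Rightarrow> 'y \<Rightarrow> 'r \<Rightarrow> real) \<Rightarrow> real \<Rightarrow> nat \<Rightarrow> ereal" where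
  "infoNCE_loss Q s \<tau> K =
    - ext_expectation (PiM {1..K} (\<lambda>_. Q))
        (\<lambda>w. let x = (\<lambda>i. fst (fst (w i))); y = (\<lambda>i. snd (fst (w i))); r = (\<lambda>i. snd (w i)) in
          1 / real K * (\<Sum>i = 1..K.
            ln (exp (s (x i) (y i) (r i) / \<tau>) /
                (1 / real K * (\<Sum>j = 1..K. exp (s (x i) (y j) (r i) / \<tau>))))))"

end

(*
  Divergences of densities are integrals of a ln (a / b) - a + b, which is nonnegative, so that
  Tonelli's theorem applies in [0, \<infinity>] without integrability assumptions.  Conditionally on x, replacing
  the induced law of r by any other prior can only increase the divergence from the product of the
  marginals; averaging over x gives I(r; y | x) \<le> E KL(q || prior).  By the chain rule
  I(x; y) + E KL(q || prior) is the divergence of p(x, y) q(r | x, y) from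
  p(x) p(y) prior(r | x), and each of the K summands of InfoNCE is a Donsker-Varadhan type lower
  bound for that divergence, conditionally on the K - 1 other samples.
*)

theory Submission
  imports Defs
begin

text \<open>The second inequality is not deduced from the first. That route writes I(x; y) as I((x,
  r); y) - I(r; y | x), a difference that is meaningless when both terms are infinite. Comparing
  from the outset with the reference p(x) p(y) prior(r | x) keeps the information quantities in sums
  within [0, \<infinity>], and the regularisation loss is moved to the other side only at the very
  end. If that loss is infinite, the move is sound only because -InfoNCE is below \<infinity>; this
  is why the contrastive bound is stated as a minimum with ln K. The InfoNCE integrand has no sign,
  and its expectation may be -\<infinity>. The ratio under the logarithm never exceeds K, so the
  deficit ln K - ln ratio is nonnegative, and it is the deficit that gets integrated.\<close>

text \<open>
  The terms \<open>- a + b\<close> cancel on integrating probability densities and make the integrand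
  nonnegative.  The value at \<open>a = \<infinity>\<close> or \<open>b = \<infinity>\<close> is junk.
\<close>

definition kl_term :: "ennreal \<Rightarrow> ennreal \<Rightarrow> ennreal" where
  "kl_term a b =
    (if a = 0 then b else if b = 0 then \<infinity>
     else ennreal (enn2real a * ln (enn2real a / enn2real b) - enn2real a + enn2real b))"

section \<open>Pointwise properties of the divergence integrand\<close>

lemma kl_term_0_left [simp]: "kl_term 0 b = b"
  by (simp add: kl_term_def)

lemma borel_measurable_kl_term [measurable]:
  assumes [measurable]: "f \<in> borel_measurable M" "g \<in> borel_measurable M"
  shows "(\<lambda>x. kl_term (f x) (g x)) \<in> borel_measurable M"
  unfolding kl_term_def by measurable

lemma diff_le_mult_ln_div:
  fixes x y :: real
  assumes "x > 0" "y > 0"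
  shows "x - y \<le> x * ln (x / y)"
proof -
  have "ln (y / x) \<le> y / x - 1"
    using assms by (intro ln_le_minus_one) auto
  then have "x * ln (y / x) \<le> x * (y / x - 1)"
    using assms by (intro mult_left_mono) auto
  then show ?thesis
    using assms by (simp add: ln_div algebra_simps)
qed

text \<open>The last premise keeps out the branch with value \<infinity>; the branch for a vanishing
  first argument agrees with the real formula.\<close>

lemma kl_term_ennreal:
  assumes "x \<ge> 0" "y \<ge> 0" "y = 0 \<Longrightarrow> x = 0"
  shows "kl_term (ennreal x) (ennreal y) = ennreal (x * ln (x / y) - x + y)"
  using assms by (auto simp: kl_term_def)

lemma mult_ln_div_nonneg:
  fixes x y :: real
  assumes "x \<ge> 0" "y \<ge> 0" "y = 0 \<Longrightarrow> x = 0"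
  shows "0 \<le> x * ln (x / y) - x + y"
proof (cases "x = 0")
  case False
  then show ?thesis
    using assms diff_le_mult_ln_div[of x y] by (cases "y = 0") auto
qed (use assms in auto)

text \<open>Homogeneity of degree one: a weight common to both densities can be pulled out and made
  part of the measure of integration.\<close>

lemma kl_term_mult:
  assumes "c < \<infinity>" "a < \<infinity>" "b < \<infinity>"
  shows "kl_term (c * a) (c * b) = c * kl_term a b"
proof (cases "c = 0 \<or> a = 0 \<or> b = 0")
  case True
  then show ?thesis by (auto simp: kl_term_def ennreal_mult_top)
next
  case False
  obtain x y z where xyz: "a = ennreal x" "b = ennreal y" "c = ennreal z" "x > 0" "y > 0" "z > 0"
    using assms False by (cases a; cases b; cases c) (auto simp: less_le)
  have "kl_term (c * a) (c * b) = ennreal (z * (x * ln (x / y) - x + y))"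
    unfolding xyz using xyz(4-)
    by (subst (1 2) ennreal_mult[symmetric], simp_all, subst kl_term_ennreal)
       (auto simp: algebra_simps)
  also have "\<dots> = c * kl_term a b"
    unfolding xyz using xyz(4-) mult_ln_div_nonneg[of x y]
    by (simp add: kl_term_ennreal ennreal_mult)
  finally show ?thesis .
qed

section \<open>Divergence and mutual information of laws with densities\<close>

lemma absolutely_continuous_density_iff:
  assumes [measurable]: "a \<in> borel_measurable N" "b \<in> borel_measurable N"
  shows "absolutely_continuous (density N b) (density N a) \<longleftrightarrow> (AE x in N. b x = 0 \<longrightarrow> a x = 0)"
proof
  assume ac: "absolutely_continuous (density N b) (density N a)"
  have "{x \<in> space N. b x = 0} \<in> null_sets (density N b)"
    by (subst null_sets_density_iff) auto
  then have "{x \<in> space N. b x = 0} \<in> null_sets (density N a)"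
    using ac by (auto simp: absolutely_continuous_def)
  then show "AE x in N. b x = 0 \<longrightarrow> a x = 0"
    by (subst (asm) null_sets_density_iff) auto
next
  assume "AE x in N. b x = 0 \<longrightarrow> a x = 0"
  then show "absolutely_continuous (density N b) (density N a)"
    by (auto simp: absolutely_continuous_def null_sets_density_iff)
qed

lemma AE_finite_of_nn_integral_eq_1:
  assumes "f \<in> borel_measurable N" "(\<integral>\<^sup>+x. f x \<partial>N) = 1"
  shows "AE x in N. f x < \<infinity>"
  using nn_integral_noteq_infinite[of f N] assms by (auto simp: less_top)

text \<open>The terms \<open>- f + g\<close> are integrable with total zero, so integrability of the
  logarithmic density under \<open>density N a\<close> amounts to finiteness of a nonnegative
  integral. Failure of absolute continuity shows up as the value \<infinity> of
  \<open>kl_term\<close> on a set that is not null.\<close>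

lemma KL_eq_nn_integral_kl_term:
  assumes a [measurable]: "a \<in> borel_measurable N" and b [measurable]: "b \<in> borel_measurable N"
    and a1: "(\<integral>\<^sup>+x. a x \<partial>N) = 1" and b1: "(\<integral>\<^sup>+x. b x \<partial>N) = 1"
  shows "KL (density N a) (density N b) = (\<integral>\<^sup>+x. kl_term (a x) (b x) \<partial>N)"
proof (cases "AE x in N. b x = 0 \<longrightarrow> a x = 0")
  case False
  have "(\<integral>\<^sup>+x. kl_term (a x) (b x) \<partial>N) = \<infinity>"
  proof (rule ccontr)
    assume "(\<integral>\<^sup>+x. kl_term (a x) (b x) \<partial>N) \<noteq> \<infinity>"
    then have "AE x in N. kl_term (a x) (b x) \<noteq> \<infinity>"
      by (intro nn_integral_noteq_infinite) auto
    then have "AE x in N. b x = 0 \<longrightarrow> a x = 0"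
      by eventually_elim (auto simp: kl_term_def split: if_splits)
    with False show False by blast
  qed
  with False show ?thesis
    by (simp add: KL_def absolutely_continuous_density_iff)
next
  case True
  interpret Q: prob_space "density N b"
    by (rule prob_spaceI) (simp add: emeasure_density b1 cong: nn_integral_cong)
  define f g L where "f x = enn2real (a x)" "g x = enn2real (b x)" "L x = ln (f x / g x)" for x
  have [measurable]: "f \<in> borel_measurable N" "g \<in> borel_measurable N" "L \<in> borel_measurable N"
    unfolding f_g_L_def by measurable
  have f0: "\<And>x. f x \<ge> 0" "\<And>x. g x \<ge> 0" by (simp_all add: f_g_L_def)
  have finite: "AE x in N. a x < \<infinity> \<and> b x < \<infinity>"
    using AE_finite_of_nn_integral_eq_1[OF a a1] AE_finite_of_nn_integral_eq_1[OF b b1] by auto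
  have af: "AE x in N. a x = ennreal (f x)" and bg: "AE x in N. b x = ennreal (g x)"
    using finite by (auto simp: f_g_L_def less_top)
  have intf: "integrable N f" "integral\<^sup>L N f = 1" 
    using a1 nn_integral_cong_AE[OF af]
    by (auto intro!: integrableI_nonneg simp: integral_eq_nn_integral f0)
  have intg: "integrable N g" "integral\<^sup>L N g = 1"
    using b1 nn_integral_cong_AE[OF bg]
    by (auto intro!: integrableI_nonneg simp: integral_eq_nn_integral f0)
  have dens: "density (density N b) (\<lambda>x. a x / b x) = density N a"
    unfolding density_density_eq[OF b borel_measurable_divide_ennreal[OF a b]]
  proof (rule density_cong)
    show "AE x in N. b x * (a x / b x) = a x"
      using True finite
      by eventually_elim (auto simp: ennreal_times_divide mult_divide_eq_ennreal mult.commute)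
  qed auto
  have "AE x in density N b. a x / b x = RN_deriv (density N b) (density N a) x"
    by (rule Q.RN_deriv_unique[OF _ dens]) auto
  then have "AE x in N. b x > 0 \<longrightarrow> RN_deriv (density N b) (density N a) x = a x / b x"
    by (subst (asm) AE_density) (auto simp: eq_commute)
  \<comment> \<open>The Radon-Nikodym derivative is determined only where \<open>b\<close> is
    positive. Elsewhere \<open>a\<close>, and with it \<open>f\<close>, vanishes almost everywhere,
    so the identity is stated with the factor \<open>f\<close>.\<close>
  then have ent: "AE x in N. f x * entropy_density (exp 1) (density N b) (density N a) x = f x * L x"
    using True finite
  proof eventually_elim
    case (elim x)
    then show ?case
      by (cases "a x"; cases "b x")
         (auto simp: entropy_density_def f_g_L_def log_def divide_ennreal less_le)
  qed
  have [measurable]: "entropy_density (exp 1) (density N b) (density N a) \<in> borel_measurable N"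
    by (simp add: entropy_density_def)
  have na: "density N a = density N (\<lambda>x. ennreal (f x))"
    using af by (intro density_cong) auto
  have iff: "integrable (density N a) (entropy_density (exp 1) (density N b) (density N a))
      \<longleftrightarrow> integrable N (\<lambda>x. f x * L x)"
  proof -
    have "integrable (density N a) (entropy_density (exp 1) (density N b) (density N a))
      \<longleftrightarrow> integrable N (\<lambda>x. f x * entropy_density (exp 1) (density N b) (density N a) x)"
      by (subst na, subst integrable_density) (auto simp: f0 mult.commute)
    also have "\<dots> \<longleftrightarrow> integrable N (\<lambda>x. f x * L x)"
      by (rule integrable_cong_AE) (use ent in auto)
    finally show ?thesis .
  qed
  have kl: "AE x in N. kl_term (a x) (b x) = ennreal (f x * L x - f x + g x)
      \<and> 0 \<le> f x * L x - f x + g x"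
    using True finite
  proof eventually_elim
    case (elim x)
    then have "a x = ennreal (f x)" "b x = ennreal (g x)" "f x \<ge> 0" "g x \<ge> 0" "g x = 0 \<Longrightarrow> f x = 0"
      by (auto simp: f_g_L_def less_top enn2real_eq_0_iff)
    then show ?case
      by (simp add: kl_term_ennreal mult_ln_div_nonneg f_g_L_def(3))
  qed
  have KL_nn: "(\<integral>\<^sup>+x. kl_term (a x) (b x) \<partial>N) = (\<integral>\<^sup>+x. ennreal (f x * L x - f x + g x) \<partial>N)"
    using kl by (intro nn_integral_cong_AE) auto
  show ?thesis
  proof (cases "integrable N (\<lambda>x. f x * L x)")
    case int: True
    have "KL_divergence (exp 1) (density N b) (density N a) = (\<integral>x. f x * L x \<partial>N)"
    proof -
      have "(\<integral>x. entropy_density (exp 1) (density N b) (density N a) x \<partial>density N a)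
        = (\<integral>x. entropy_density (exp 1) (density N b) (density N a) x \<partial>density N (\<lambda>x. ennreal (f x)))"
        by (simp only: na[symmetric])
      also have "\<dots> = (\<integral>x. f x * L x \<partial>N)"
        using ent by (subst integral_density) (auto intro!: integral_cong_AE simp: f0)
      finally show ?thesis
        by (simp add: KL_divergence_def)
    qed
    moreover have "(\<integral>\<^sup>+x. ennreal (f x * L x - f x + g x) \<partial>N) = ennreal (\<integral>x. f x * L x - f x + g x \<partial>N)"
      using int intf(1) intg(1) kl by (intro nn_integral_eq_integral) auto
    moreover have "(\<integral>x. f x * L x - f x + g x \<partial>N) = (\<integral>x. f x * L x \<partial>N)"
      using int intf intg by simp
    ultimately show ?thesis
      using True int iff by (simp add: KL_def absolutely_continuous_density_iff KL_nn)
  next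
    case nint: False
    have "(\<integral>\<^sup>+x. ennreal (f x * L x - f x + g x) \<partial>N) = \<infinity>"
    proof (rule ccontr)
      assume "(\<integral>\<^sup>+x. ennreal (f x * L x - f x + g x) \<partial>N) \<noteq> \<infinity>"
      then have "integrable N (\<lambda>x. f x * L x - f x + g x)"
        using kl by (intro integrableI_nonneg) (auto simp: less_top)
      from Bochner_Integration.integrable_diff[OF Bochner_Integration.integrable_add[OF this intf(1)] intg(1)]
      show False using nint by simp
    qed
    then show ?thesis
      using nint iff by (simp add: KL_def KL_nn)
  qed
qed

text \<open>The product of the marginal laws has the product of the marginal densities as its
  density. The formula serves twice: for the pair (x, y), and for (r, y) under the conditional law
  at a fixed x.\<close>

lemma (in prob_space) mutual_info_distributed:
  assumes S: "sigma_finite_measure S" and T: "sigma_finite_measure T"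
    and XY: "distributed M (S \<Otimes>\<^sub>M T) (\<lambda>\<omega>. (X \<omega>, Y \<omega>)) f"
  shows "mutual_info M S T X Y =
    (\<integral>\<^sup>+z. kl_term (f z) ((\<integral>\<^sup>+y. f (fst z, y) \<partial>T) * (\<integral>\<^sup>+x. f (x, snd z) \<partial>S)) \<partial>(S \<Otimes>\<^sub>M T))"
proof -
  interpret S: sigma_finite_measure S by fact
  interpret T: sigma_finite_measure T by fact
  interpret ST: pair_sigma_finite S T ..
  have f [measurable]: "f \<in> borel_measurable (S \<Otimes>\<^sub>M T)"
    using XY by (rule distributed_borel_measurable)
  have rv: "random_variable (S \<Otimes>\<^sub>M T) (\<lambda>\<omega>. (X \<omega>, Y \<omega>))"
    using XY by (rule distributed_measurable)
  have "fst \<circ> (\<lambda>\<omega>. (X \<omega>, Y \<omega>)) \<in> measurable M S" "snd \<circ> (\<lambda>\<omega>. (X \<omega>, Y \<omega>)) \<in> measurable M T"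
    by (rule measurable_comp[OF rv], simp)+
  then have X: "random_variable S X" and Y: "random_variable T Y"
    by (simp_all add: comp_def)
  define fX fY where "fX x = (\<integral>\<^sup>+y. f (x, y) \<partial>T)" "fY y = (\<integral>\<^sup>+x. f (x, y) \<partial>S)" for x y
  have [measurable]: "fX \<in> borel_measurable S" "fY \<in> borel_measurable T"
    unfolding fX_fY_def by measurable
  have dX: "distr M S X = density S fX"
    using distributed_distr_eq_density[OF distr_marginal1[OF S T XY]] fX_fY_def(1)[abs_def] by simp
  have dY: "distr M T Y = density T fY"
    using distributed_distr_eq_density[OF distr_marginal2[OF S T XY]] fX_fY_def(2)[abs_def] by simp
  interpret DX: prob_space "density S fX"
    using prob_space_distr[OF X] by (simp add: dX)
  interpret DY: prob_space "density T fY"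
    using prob_space_distr[OF Y] by (simp add: dY)
  interpret DXY: pair_prob_space "density S fX" "density T fY" ..
  have prod: "density S fX \<Otimes>\<^sub>M density T fY = density (S \<Otimes>\<^sub>M T) (\<lambda>z. fX (fst z) * fY (snd z))"
    by (subst pair_measure_density) (auto simp: split_beta' intro: T DY.sigma_finite_measure_axioms)
  have f1: "(\<integral>\<^sup>+z. f z \<partial>(S \<Otimes>\<^sub>M T)) = 1"
    using prob_space.emeasure_space_1[OF prob_space_distr[OF rv]]
    by (simp add: distributed_distr_eq_density[OF XY] emeasure_density cong: nn_integral_cong)
  have fXY1: "(\<integral>\<^sup>+z. fX (fst z) * fY (snd z) \<partial>(S \<Otimes>\<^sub>M T)) = 1"
    using DXY.emeasure_space_1
    by (simp add: prod emeasure_density space_pair_measure[symmetric] cong: nn_integral_cong)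
  show ?thesis
    unfolding mutual_info_def distributed_distr_eq_density[OF XY] dX dY prod fX_fY_def[symmetric]
    by (rule KL_eq_nn_integral_kl_term[OF _ _ f1 fXY1]) auto
qed

section \<open>The mean as the best constant reference\<close>

text \<open>The discarded term is the nonnegative divergence between the mean of \<open>a\<close> and \<open>b\<close>.\<close>

lemma (in prob_space) nn_integral_kl_term_mean_le:
  assumes a [measurable]: "a \<in> borel_measurable M"
    and fin: "(\<integral>\<^sup>+x. a x \<partial>M) < \<infinity>" and b: "b < \<infinity>"
  shows "(\<integral>\<^sup>+x. kl_term (a x) (\<integral>\<^sup>+x. a x \<partial>M) \<partial>M) \<le> (\<integral>\<^sup>+x. kl_term (a x) b \<partial>M)"
proof -
  define m where "m = (\<integral>\<^sup>+x. a x \<partial>M)"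
  have a_fin: "AE x in M. a x < \<infinity>"
    using nn_integral_noteq_infinite[of a M] fin by (auto simp: less_top)
  consider "m = 0" | "m \<noteq> 0" "b = 0" | "m \<noteq> 0" "b \<noteq> 0" by blast
  then show ?thesis
    unfolding m_def[symmetric]
  proof cases
    case 1
    then have "AE x in M. a x = 0"
      by (simp add: m_def nn_integral_0_iff_AE)
    then have "AE x in M. kl_term (a x) m = 0"
      by eventually_elim (simp add: 1)
    then have "(\<integral>\<^sup>+x. kl_term (a x) m \<partial>M) = 0"
      by (simp add: nn_integral_0_iff_AE)
    then show "(\<integral>\<^sup>+x. kl_term (a x) m \<partial>M) \<le> (\<integral>\<^sup>+x. kl_term (a x) b \<partial>M)" by simp
  next
    case 2
    have "(\<integral>\<^sup>+x. kl_term (a x) b \<partial>M) = \<infinity>"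
    proof (rule ccontr)
      assume "(\<integral>\<^sup>+x. kl_term (a x) b \<partial>M) \<noteq> \<infinity>"
      then have "AE x in M. kl_term (a x) b \<noteq> \<infinity>"
        by (intro nn_integral_noteq_infinite) auto
      then have "AE x in M. a x = 0"
        by eventually_elim (auto simp: kl_term_def 2 split: if_splits)
      then have "m = 0"
        by (simp add: m_def nn_integral_0_iff_AE)
      with 2 show False by simp
    qed
    then show "(\<integral>\<^sup>+x. kl_term (a x) m \<partial>M) \<le> (\<integral>\<^sup>+x. kl_term (a x) b \<partial>M)" by simp
  next
    case 3
    obtain r s where rs: "m = ennreal r" "b = ennreal s" "r > 0" "s > 0"
      using 3 fin b unfolding m_def[symmetric] by (cases m; cases b) (auto simp: less_le)
    define c where "c = ln (r / s)"
    \<comment> \<open>Changing the reference from \<open>r\<close> to \<open>s\<close> adds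
      \<open>c * t\<close> to the logarithmic term, and \<open>c\<close> may have either sign. Its
      positive and negative parts go to opposite sides, so that the identity \<open>pt\<close> lives
      in [0, \<infinity>].\<close>
    define cp cm where "cp = max 0 c" "cm = max 0 (- c)"
    have c: "cp \<ge> 0" "cm \<ge> 0" "cp = c + cm"
      by (auto simp: cp_cm_def)
    have pt: "AE x in M. kl_term (a x) b + ennreal (cm) * a x + m
        = kl_term (a x) m + ennreal (cp) * a x + b"
      using a_fin
    proof eventually_elim
      case (elim x)
      then obtain t where t: "a x = ennreal t" "t \<ge> 0"
        by (cases "a x") auto
      have "t * ln (t / s) = t * ln (t / r) + c * t"
        using rs t by (cases "t = 0") (auto simp: c_def ln_div algebra_simps)
      then have eq: "(t * ln (t / s) - t + s) + cm * t + r = (t * ln (t / r) - t + r) + cp * t + s"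
        by (simp add: c(3) distrib_right)
      have "kl_term (a x) b + ennreal (cm) * a x + m
          = ennreal ((t * ln (t / s) - t + s) + cm * t + r)"
        unfolding t rs using t rs c mult_ln_div_nonneg[of t s]
        by (subst kl_term_ennreal) (auto simp flip: ennreal_mult ennreal_plus)
      also have "\<dots> = kl_term (a x) m + ennreal (cp) * a x + b"
        unfolding eq t rs using t rs c mult_ln_div_nonneg[of t r]
        by (subst kl_term_ennreal) (auto simp flip: ennreal_mult ennreal_plus)
      finally show ?case .
    qed
    have "(\<integral>\<^sup>+x. kl_term (a x) b + ennreal (cm) * a x + m \<partial>M)
        = (\<integral>\<^sup>+x. kl_term (a x) m + ennreal (cp) * a x + b \<partial>M)"
      by (rule nn_integral_cong_AE[OF pt])
    then have eq: "(\<integral>\<^sup>+x. kl_term (a x) b \<partial>M) + (ennreal (cm) * m + m)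
        = (\<integral>\<^sup>+x. kl_term (a x) m \<partial>M) + (ennreal (cp) * m + b)"
      by (simp add: nn_integral_add nn_integral_cmult emeasure_space_1 add.assoc flip: m_def)
    have "ennreal (cm) * m + m \<le> ennreal (cp) * m + b"
    proof -
      have "cm * r + r \<le> cp * r + s"
      proof -
        have "0 \<le> r * c - r + s"
          unfolding c_def using rs by (intro mult_ln_div_nonneg) auto
        then show ?thesis by (simp add: c(3) algebra_simps)
      qed
      then show ?thesis
        unfolding rs using rs c by (subst (1 2) ennreal_mult[symmetric]; simp flip: ennreal_plus)
    qed
    then have "(\<integral>\<^sup>+x. kl_term (a x) m \<partial>M) + (ennreal (cm) * m + m)
      \<le> (\<integral>\<^sup>+x. kl_term (a x) b \<partial>M) + (ennreal (cm) * m + m)"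
      unfolding eq by (rule add_left_mono)
    moreover have "ennreal (cm) * m + m < \<infinity>"
      by (simp add: rs ennreal_mult_less_top)
    ultimately show "(\<integral>\<^sup>+x. kl_term (a x) m \<partial>M) \<le> (\<integral>\<^sup>+x. kl_term (a x) b \<partial>M)"
      by (auto simp: add.commute ennreal_add_left_cancel_le)
  qed
qed

section \<open>Chain rule and Young inequality for the integrand\<close>

text \<open>The logarithm of the quotient of products splits. The linear corrections do not match
  term by term, so each one that would be subtracted is added on the other side instead.\<close>

lemma kl_term_chain_pointwise:
  assumes fin: "p < \<infinity>" "c < \<infinity>" "q < \<infinity>" "\<pi> < \<infinity>" and "p \<noteq> 0"
  shows "kl_term (p * q) (c * \<pi>) + c * q + p * \<pi>
    = q * kl_term p c + p * kl_term q \<pi> + (p * q + c * \<pi>)"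
proof (cases "q = 0 \<or> c = 0 \<or> \<pi> = 0")
  case True
  then show ?thesis
    using assms by (auto simp: kl_term_def ennreal_mult_top add.commute ennreal_mult_eq_top_iff)
next
  case False
  obtain a b d e where abde: "p = ennreal a" "c = ennreal b" "q = ennreal d" "\<pi> = ennreal e"
      "a > 0" "b > 0" "d > 0" "e > 0"
    using assms False by (cases p; cases c; cases q; cases \<pi>) (auto simp: less_le)
  have ln: "ln ((a * d) / (b * e)) = ln (a / b) + ln (d / e)"
    using abde by (simp add: ln_div ln_mult)
  have pos: "a * d > 0" "b * e > 0" "b * d > 0" "a * e > 0"
    using abde by auto
  have nn: "0 \<le> a * ln (a / b) - a + b" "0 \<le> d * ln (d / e) - d + e"
    "0 \<le> (a * d) * ln ((a * d) / (b * e)) - (a * d) + (b * e)"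
    using abde by (intro mult_ln_div_nonneg; simp)+
  have kl: "kl_term (ennreal (a * d)) (ennreal (b * e))
    = ennreal ((a * d) * ln ((a * d) / (b * e)) - (a * d) + (b * e))"
    by (rule kl_term_ennreal) (use pos in auto)
  have "kl_term (p * q) (c * \<pi>) + c * q + p * \<pi>
    = ennreal (((a * d) * ln ((a * d) / (b * e)) - (a * d) + (b * e)) + b * d + a * e)"
    unfolding abde using abde(5-) nn pos
    by (simp add: kl kl_term_ennreal ennreal_mult[symmetric] ennreal_plus[symmetric] del: ennreal_plus)
  also have "((a * d) * ln ((a * d) / (b * e)) - (a * d) + (b * e)) + b * d + a * e
    = d * (a * ln (a / b) - a + b) + a * (d * ln (d / e) - d + e) + (a * d + b * e)"
    unfolding ln by (simp add: algebra_simps)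
  also have "ennreal \<dots> = q * kl_term p c + p * kl_term q \<pi> + (p * q + c * \<pi>)"
    unfolding abde using abde(5-) nn pos
    by (simp add: kl_term_ennreal ennreal_mult[symmetric] ennreal_plus[symmetric] del: ennreal_plus)
  finally show ?thesis .
qed

text \<open>After integration over \<open>r\<close> the corrections amount to \<open>c + p\<close>
  on both sides and cancel, being finite. The normalisations are conditional because a conditional
  density integrates to one only where the variable conditioned on has positive density; for
  \<open>p = 0\<close> both sides equal \<open>c\<close>.\<close>

lemma nn_integral_kl_term_chain:
  assumes q [measurable]: "q \<in> borel_measurable N" and \<pi> [measurable]: "\<pi> \<in> borel_measurable N"
    and fin: "p < \<infinity>" "c < \<infinity>"
    and q1: "p \<noteq> 0 \<Longrightarrow> (\<integral>\<^sup>+r. q r \<partial>N) = 1"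
    and \<pi>1: "p \<noteq> 0 \<or> c \<noteq> 0 \<Longrightarrow> (\<integral>\<^sup>+r. \<pi> r \<partial>N) = 1"
  shows "(\<integral>\<^sup>+r. kl_term (p * q r) (c * \<pi> r) \<partial>N) = kl_term p c + p * (\<integral>\<^sup>+r. kl_term (q r) (\<pi> r) \<partial>N)"
proof (cases "p = 0")
  case True
  then show ?thesis
    using \<pi>1 by (cases "c = 0") (auto simp: nn_integral_cmult)
next
  case False
  have fin': "AE r in N. q r < \<infinity> \<and> \<pi> r < \<infinity>"
    using AE_finite_of_nn_integral_eq_1[OF q] AE_finite_of_nn_integral_eq_1[OF \<pi>] q1 \<pi>1 False by auto
  have "(\<integral>\<^sup>+r. kl_term (p * q r) (c * \<pi> r) + c * q r + p * \<pi> r \<partial>N)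
    = (\<integral>\<^sup>+r. q r * kl_term p c + p * kl_term (q r) (\<pi> r) + (p * q r + c * \<pi> r) \<partial>N)"
    using fin' by (intro nn_integral_cong_AE, eventually_elim)
      (use fin False in \<open>simp add: kl_term_chain_pointwise\<close>)
  then have "(\<integral>\<^sup>+r. kl_term (p * q r) (c * \<pi> r) \<partial>N) + (c + p)
    = (kl_term p c + p * (\<integral>\<^sup>+r. kl_term (q r) (\<pi> r) \<partial>N)) + (p + c)"
    using q1 \<pi>1 False
    by (simp add: nn_integral_add nn_integral_cmult nn_integral_multc add.assoc)
  then show ?thesis
    using fin by (auto simp: add.commute[of c p])
qed

text \<open>This is Young's inequality \<open>a * t + b\<close> \<le>
  \<open>kl_term a b + b * exp t\<close> at \<open>t = k - u\<close>, with the negative part of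
  \<open>t\<close> moved to the right. It expresses that the divergence integrand of
  \<open>a\<close> against \<open>b * exp t\<close> is nonnegative.\<close>

lemma kl_term_variational:
  assumes fin: "a < \<infinity>" "b < \<infinity>" and u: "u \<ge> 0" "k \<ge> 0"
  shows "a * ennreal k + b \<le> kl_term a b + b * ennreal (exp (k - u)) + a * ennreal u"
proof (cases "a = 0 \<or> b = 0")
  case True
  then show ?thesis by (auto simp: kl_term_def)
next
  case False
  obtain x y where xy: "a = ennreal x" "b = ennreal y" "x > 0" "y > 0"
    using False fin by (cases a; cases b) (auto simp: less_le)
  have "0 \<le> x * ln (x / (y * exp (k - u))) - x + y * exp (k - u)"
    using xy by (intro mult_ln_div_nonneg) auto
  also have "ln (x / (y * exp (k - u))) = ln (x / y) - (k - u)"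
    using xy by (simp add: ln_div ln_mult)
  finally have "x * k + y \<le> (x * ln (x / y) - x + y) + y * exp (k - u) + x * u"
    by (simp add: algebra_simps)
  then have "ennreal (x * k + y) \<le> ennreal ((x * ln (x / y) - x + y) + y * exp (k - u) + x * u)"
    by (rule ennreal_leI)
  then show ?thesis
    unfolding xy using xy(3-) u mult_ln_div_nonneg[of x y]
    by (simp add: kl_term_ennreal ennreal_mult[symmetric] ennreal_plus[symmetric] del: ennreal_plus)
qed

section \<open>Resampling and reordering of integrals\<close>

text \<open>Overwriting one coordinate by an independent draw from its own law preserves the product
  law. This stands in for conditioning on the other coordinates, while the sample space stays the
  same.\<close>

lemma (in product_prob_space) nn_integral_PiM_resample:
  assumes "finite I" "i \<in> I" and F [measurable]: "F \<in> borel_measurable (PiM I M)"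
  shows "(\<integral>\<^sup>+w. (\<integral>\<^sup>+z. F (w(i := z)) \<partial>M i) \<partial>PiM I M) = (\<integral>\<^sup>+w. F w \<partial>PiM I M)"
proof -
  have ins: "insert i (I - {i}) = I" using assms by auto
  define G where "G w = (\<integral>\<^sup>+z. F (w(i := z)) \<partial>M i)" for w
  have upd: "(\<lambda>(w, z). w(i := z)) \<in> measurable (PiM I M \<Otimes>\<^sub>M M i) (PiM I M)"
    using measurable_add_dim[of i I M] by (simp add: assms insert_absorb)
  have [measurable]: "(\<lambda>(w, z). F (w(i := z))) \<in> borel_measurable (PiM I M \<Otimes>\<^sub>M M i)"
    using measurable_compose[OF upd F] by (simp add: split_beta')
  have [measurable]: "G \<in> borel_measurable (PiM I M)"
    unfolding G_def[abs_def] by measurable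
  have eq: "(\<integral>\<^sup>+w. H w \<partial>PiM I M) = (\<integral>\<^sup>+w. (\<integral>\<^sup>+z. H (w(i := z)) \<partial>M i) \<partial>PiM (I - {i}) M)"
    if "H \<in> borel_measurable (PiM I M)" for H
    using product_nn_integral_insert[of "I - {i}" i H] assms(1) that unfolding ins by simp
  \<comment> \<open>\<open>G\<close> ignores coordinate \<open>i\<close>, so the inner integral is
    that of a constant.\<close>
  have "(\<integral>\<^sup>+w. G w \<partial>PiM I M) = (\<integral>\<^sup>+w. (\<integral>\<^sup>+z. G w \<partial>M i) \<partial>PiM (I - {i}) M)"
    by (subst eq) (simp_all add: G_def)
  also have "\<dots> = (\<integral>\<^sup>+w. G w \<partial>PiM (I - {i}) M)"
    by (simp add: M.emeasure_space_1)
  also have "\<dots> = (\<integral>\<^sup>+w. F w \<partial>PiM I M)"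
    by (subst eq[OF F]) (simp add: G_def[abs_def])
  finally show ?thesis by (simp add: G_def)
qed

text \<open>Puts \<open>y\<close> innermost, so that (x, r) can be held fixed while \<open>y\<close>
  is integrated against its marginal.\<close>

lemma nn_integral_pair_rotate:
  assumes "sigma_finite_measure MX" "sigma_finite_measure MY" "sigma_finite_measure MR"
    and G [measurable]: "G \<in> borel_measurable ((MX \<Otimes>\<^sub>M MY) \<Otimes>\<^sub>M MR)"
  shows "(\<integral>\<^sup>+z. G z \<partial>((MX \<Otimes>\<^sub>M MY) \<Otimes>\<^sub>M MR))
    = (\<integral>\<^sup>+v. (\<integral>\<^sup>+y. G ((fst v, y), snd v) \<partial>MY) \<partial>(MX \<Otimes>\<^sub>M MR))"
proof -
  interpret X: sigma_finite_measure MX by fact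
  interpret Y: sigma_finite_measure MY by fact
  interpret R: sigma_finite_measure MR by fact
  interpret YR: pair_sigma_finite MY MR ..
  have "(\<integral>\<^sup>+z. G z \<partial>((MX \<Otimes>\<^sub>M MY) \<Otimes>\<^sub>M MR)) = (\<integral>\<^sup>+z. (\<integral>\<^sup>+r. G (z, r) \<partial>MR) \<partial>(MX \<Otimes>\<^sub>M MY))"
    by (simp add: R.nn_integral_fst)
  also have "\<dots> = (\<integral>\<^sup>+x. (\<integral>\<^sup>+y. (\<integral>\<^sup>+r. G ((x, y), r) \<partial>MR) \<partial>MY) \<partial>MX)"
    by (rule Y.nn_integral_fst[symmetric]) measurable
  also have "\<dots> = (\<integral>\<^sup>+x. (\<integral>\<^sup>+r. (\<integral>\<^sup>+y. G ((x, y), r) \<partial>MY) \<partial>MR) \<partial>MX)"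
    by (intro nn_integral_cong YR.Fubini'[symmetric]) measurable
  also have "\<dots> = (\<integral>\<^sup>+v. (\<integral>\<^sup>+y. G ((fst v, y), snd v) \<partial>MY) \<partial>(MX \<Otimes>\<^sub>M MR))"
    by (subst R.nn_integral_fst[symmetric]) simp_all
  finally show ?thesis .
qed

section \<open>The contrastive ratio and extended expectations\<close>

text \<open>The anchor \<open>(x, r)\<close> is an argument separate from the candidates
  \<open>\<eta>\<close>: in InfoNCE it comes from the same triple as candidate \<open>i\<close>, but
  under the reference law it is independent of all candidates.\<close>

definition nce_ratio ::
  "('x \<Rightarrow> 'y \<Rightarrow> 'r \<Rightarrow> real) \<Rightarrow> real \<Rightarrow> nat \<Rightarrow> nat \<Rightarrow> 'x \<Rightarrow> 'r \<Rightarrow> (nat \<Rightarrow> 'y) \<Rightarrow> real" where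
  "nce_ratio s \<tau> K i x r \<eta> =
    exp (s x (\<eta> i) r / \<tau>) / (1 / real K * (\<Sum>j = 1..K. exp (s x (\<eta> j) r / \<tau>)))"

lemma nce_ratio_pos: "K \<ge> 1 \<Longrightarrow> nce_ratio s \<tau> K i x r \<eta> > 0"
  unfolding nce_ratio_def by (intro divide_pos_pos mult_pos_pos sum_pos) auto

text \<open>The mean in the denominator is at least 1/K times the numerator, one of its own terms.
  This is the origin of the ceiling ln K.\<close>

lemma nce_ratio_le:
  assumes "i \<in> {1..K}"
  shows "nce_ratio s \<tau> K i x r \<eta> \<le> real K"
proof -
  have "exp (s x (\<eta> i) r / \<tau>) \<le> (\<Sum>j = 1..K. exp (s x (\<eta> j) r / \<tau>))"
    using assms by (intro member_le_sum) auto
  moreover have "(\<Sum>j = 1..K. exp (s x (\<eta> j) r / \<tau>)) > 0"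
    using assms by (intro sum_pos) auto
  ultimately show ?thesis
    using assms by (simp add: nce_ratio_def field_simps)
qed

text \<open>For a common anchor the K denominators coincide, and the numerators add up to K times
  that denominator.\<close>

lemma sum_nce_ratio:
  assumes "K \<ge> 1"
  shows "(\<Sum>i = 1..K. nce_ratio s \<tau> K i x r \<eta>) = real K"
proof -
  have "(\<Sum>j = 1..K. exp (s x (\<eta> j) r / \<tau>)) > 0"
    using assms by (intro sum_pos) auto
  then show ?thesis
    using assms by (simp add: nce_ratio_def flip: sum_divide_distrib sum_distrib_right)
qed

lemma borel_measurable_nce_ratio:
  assumes s: "(\<lambda>((x, y), r). s x y r) \<in> borel_measurable ((MX \<Otimes>\<^sub>M MY) \<Otimes>\<^sub>M MR)"
    and [measurable]: "f \<in> measurable N MX" "g \<in> measurable N MR"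
    and \<eta>: "\<And>j. j \<in> {1..K} \<Longrightarrow> (\<lambda>\<omega>. \<eta> \<omega> j) \<in> measurable N MY" and i: "i \<in> {1..K}"
  shows "(\<lambda>\<omega>. nce_ratio s \<tau> K i (f \<omega>) (g \<omega>) (\<eta> \<omega>)) \<in> borel_measurable N"
proof -
  have m: "(\<lambda>\<omega>. s (f \<omega>) (\<eta> \<omega> j) (g \<omega>)) \<in> borel_measurable N" if "j \<in> {1..K}" for j
  proof -
    note \<eta>[OF that, measurable]
    have "(\<lambda>\<omega>. ((f \<omega>, \<eta> \<omega> j), g \<omega>)) \<in> measurable N ((MX \<Otimes>\<^sub>M MY) \<Otimes>\<^sub>M MR)"
      by measurable
    from measurable_compose[OF this s] show ?thesis by simp
  qed
  show ?thesis
    unfolding nce_ratio_def using m i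
    by (intro borel_measurable_divide borel_measurable_times borel_measurable_sum
        borel_measurable_const borel_measurable_exp measurable_compose[OF _ borel_measurable_exp]) auto
qed

text \<open>The positive part of \<open>k - U\<close> plus \<open>U\<close> equals \<open>k\<close>
  plus the negative part, an identity free of subtraction. The positive part has mean at most
  \<open>k\<close>, so the difference defining the expectation is meaningful; if \<open>U\<close>
  has infinite mean, so has the negative part.\<close>

lemma (in prob_space) ext_expectation_le:
  assumes U [measurable]: "U \<in> borel_measurable M" and nn: "\<And>w. U w \<ge> 0" "k \<ge> 0"
    and le: "ennreal k \<le> D + (\<integral>\<^sup>+w. ennreal (U w) \<partial>M)"
  shows "ext_expectation M (\<lambda>w. k - U w) \<le> enn2ereal D"
proof -
  define pos neg IU where "pos = (\<integral>\<^sup>+w. ennreal (k - U w) \<partial>M)" "neg = (\<integral>\<^sup>+w. ennreal (- (k - U w)) \<partial>M)"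
    "IU = (\<integral>\<^sup>+w. ennreal (U w) \<partial>M)"
  have "ennreal (k - U w) + ennreal (U w) = ennreal k + ennreal (- (k - U w))" for w
    using nn(1)[of w] nn(2)
    by (cases "U w \<le> k") (simp_all add: ennreal_neg flip: ennreal_plus)
  then have "(\<integral>\<^sup>+w. ennreal (k - U w) + ennreal (U w) \<partial>M) = (\<integral>\<^sup>+w. ennreal k + ennreal (- (k - U w)) \<partial>M)"
    by simp
  then have eq: "pos + IU = ennreal k + neg"
    unfolding pos_neg_IU_def by (subst (asm) (1 2) nn_integral_add) (auto simp: emeasure_space_1)
  have "pos \<le> (\<integral>\<^sup>+w. ennreal k \<partial>M)"
    unfolding pos_neg_IU_def using nn by (intro nn_integral_mono ennreal_leI) simp
  then have pos: "pos < \<infinity>"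
    by (simp add: emeasure_space_1 le_less_trans)
  have "pos \<le> D + neg"
  proof (cases "IU = \<infinity>")
    case True
    with eq have "ennreal k + neg = \<top>" by simp
    then have "neg = \<infinity>" by simp
    then show ?thesis by simp
  next
    case False
    have "pos + IU \<le> (D + neg) + IU"
      unfolding eq using add_right_mono[OF le[folded pos_neg_IU_def(3)], of neg] by (simp add: ac_simps)
    then show ?thesis
      using False by (simp add: add.commute[of _ IU] ennreal_add_left_cancel_le)
  qed
  then have "enn2ereal pos \<le> enn2ereal D + enn2ereal neg"
    by (metis less_eq_ennreal.rep_eq plus_ennreal.rep_eq)
  then have "enn2ereal pos - enn2ereal neg \<le> enn2ereal D"
    using pos
    by (cases pos; cases neg; cases D) (auto simp: enn2ereal_ennreal)
  then show ?thesis
    by (simp add: ext_expectation_def pos_neg_IU_def)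
qed


section \<open>The contrastive lower bound\<close>

text \<open>
  Young's inequality is integrated with a fresh draw of coordinate \<open>i\<close> from the reference density
  \<open>c \<cdot> pY\<close>.  Since \<open>pY\<close> is the true \<open>y\<close>-marginal, the resulting exponential moments are
  expectations of \<open>nce_ratio\<close> under the product law; they sum to \<open>K\<close>, because the ratios do
  pointwise.
\<close>

lemma infoNCE_le:
  fixes MX :: "'x measure" and MY :: "'y measure" and MR :: "'r measure"
    and f :: "('x \<times> 'y) \<times> 'r \<Rightarrow> ennreal"
  defines "B \<equiv> (MX \<Otimes>\<^sub>M MY) \<Otimes>\<^sub>M MR"
  assumes sf: "sigma_finite_measure MX" "sigma_finite_measure MY" "sigma_finite_measure MR"
    and f [measurable]: "f \<in> borel_measurable B" and f1: "(\<integral>\<^sup>+z. f z \<partial>B) = 1"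
    and c [measurable]: "c \<in> borel_measurable (MX \<Otimes>\<^sub>M MR)" and c1: "(\<integral>\<^sup>+v. c v \<partial>(MX \<Otimes>\<^sub>M MR)) = 1"
    and pY [measurable]: "pY \<in> borel_measurable MY"
    and marg: "\<And>T. T \<in> borel_measurable MY \<Longrightarrow>
      (\<integral>\<^sup>+z. f z * T (snd (fst z)) \<partial>B) = (\<integral>\<^sup>+y. pY y * T y \<partial>MY)"
    and s: "(\<lambda>((x, y), r). s x y r) \<in> borel_measurable B"
    and K: "K \<ge> 1"
  shows "- infoNCE_loss (density B f) s \<tau> K
    \<le> enn2ereal (min (ennreal (ln (real K)))
        (\<integral>\<^sup>+z. kl_term (f z) (c (fst (fst z), snd z) * pY (snd (fst z))) \<partial>B))"
proof -
  interpret X: sigma_finite_measure MX by fact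
  interpret Y: sigma_finite_measure MY by fact
  interpret R: sigma_finite_measure MR by fact
  interpret XY: pair_sigma_finite MX MY ..
  interpret XR: pair_sigma_finite MX MR ..
  interpret BB: pair_sigma_finite "MX \<Otimes>\<^sub>M MY" MR ..
  interpret B: sigma_finite_measure B
    unfolding B_def by (rule BB.sigma_finite_measure_axioms)
  define P where "P = density B f"
  have pr: "prob_space P"
    by (rule prob_spaceI) (simp add: P_def emeasure_density f1 cong: nn_integral_cong)
  interpret P: prob_space P by (rule pr)
  interpret W: product_prob_space "\<lambda>_. P" "{1..K}" ..
  define W where "W = PiM {1..K} (\<lambda>_::nat. P)"
  interpret WV: pair_sigma_finite W "MX \<Otimes>\<^sub>M MR"
    unfolding W_def ..
  have setsP [measurable_cong]: "sets P = sets ((MX \<Otimes>\<^sub>M MY) \<Otimes>\<^sub>M MR)"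
    by (simp add: P_def B_def)
  have setsB [measurable_cong]: "sets B = sets ((MX \<Otimes>\<^sub>M MY) \<Otimes>\<^sub>M MR)"
    by (simp add: B_def)
  have W1: "emeasure W (space W) = 1"
    unfolding W_def by (rule W.P.emeasure_space_1)
  have comp: "(\<lambda>w. w i) \<in> measurable W P" if "i \<in> {1..K}" for i
    unfolding W_def by (rule measurable_component_singleton) fact
  \<comment> \<open>The reference draws (x, r) from \<open>c\<close> and \<open>y\<close>
    independently of it.\<close>
  define b where "b z = c (fst (fst z), snd z) * pY (snd (fst z))" for z
  have b [measurable]: "b \<in> borel_measurable B"
    unfolding b_def[abs_def] by measurable
  define D where "D = (\<integral>\<^sup>+z. kl_term (f z) (b z) \<partial>B)"
  define y where "y w j = snd (fst (w j))" for w :: "nat \<Rightarrow> ('x \<times> 'y) \<times> 'r" and j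
  define E where "E i v \<eta> = nce_ratio s \<tau> K i (fst v) (snd v) \<eta>" for i \<eta> and v :: "'x \<times> 'r"
  define own where "own z = (fst (fst z), snd z)" for z :: "('x \<times> 'y) \<times> 'r"
  \<comment> \<open>The deficit of summand \<open>i\<close> below the ceiling ln K.\<close>
  define U where "U i w = ln (real K) - ln (E i (own (w i)) (y w))" for i w
  have y_upd: "y (w(i := z)) = (y w)(i := snd (fst z))" for w i z
    by (auto simp: y_def)
  have E_bounds: "0 < E i v \<eta>" "E i v \<eta> \<le> real K" if "i \<in> {1..K}" for i v \<eta>
    using K that by (auto simp: E_def nce_ratio_pos nce_ratio_le)
  have U_nonneg: "U i w \<ge> 0" if "i \<in> {1..K}" for i w
    using E_bounds[OF that, of "own (w i)" "y w"] by (simp add: U_def)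
  \<comment> \<open>\<open>marg\<close> replaces the draw from \<open>pY\<close> by the
    \<open>y\<close>-component of a triple drawn from \<open>P\<close>. In this form the draw can
    later be absorbed by resampling a coordinate.\<close>
  have b_rotate: "(\<integral>\<^sup>+z. b z * T (own z) (snd (fst z)) \<partial>B)
      = (\<integral>\<^sup>+v. c v * (\<integral>\<^sup>+z. T v (snd (fst z)) \<partial>P) \<partial>(MX \<Otimes>\<^sub>M MR))"
    if T [measurable]: "case_prod T \<in> borel_measurable ((MX \<Otimes>\<^sub>M MR) \<Otimes>\<^sub>M MY)" for T
  proof -
    have m: "(\<lambda>z. b z * T (own z) (snd (fst z))) \<in> borel_measurable ((MX \<Otimes>\<^sub>M MY) \<Otimes>\<^sub>M MR)"
      using b unfolding B_def own_def by measurable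
    have "(\<integral>\<^sup>+z. b z * T (own z) (snd (fst z)) \<partial>B)
      = (\<integral>\<^sup>+v. (\<integral>\<^sup>+y. c v * (pY y * T v y) \<partial>MY) \<partial>(MX \<Otimes>\<^sub>M MR))"
      unfolding B_def by (subst nn_integral_pair_rotate[OF sf m]) (simp add: b_def own_def mult.assoc)
    also have "\<dots> = (\<integral>\<^sup>+v. c v * (\<integral>\<^sup>+z. T v (snd (fst z)) \<partial>P) \<partial>(MX \<Otimes>\<^sub>M MR))"
    proof (intro nn_integral_cong)
      fix v assume "v \<in> space (MX \<Otimes>\<^sub>M MR)"
      then have Tv [measurable]: "T v \<in> borel_measurable MY"
        using measurable_Pair2[OF T] by simp
      have "(\<integral>\<^sup>+y. pY y * T v y \<partial>MY) = (\<integral>\<^sup>+z. T v (snd (fst z)) \<partial>P)"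
        unfolding P_def by (subst nn_integral_density) (simp_all add: marg)
      then show "(\<integral>\<^sup>+y. c v * (pY y * T v y) \<partial>MY) = c v * (\<integral>\<^sup>+z. T v (snd (fst z)) \<partial>P)"
        by (simp add: nn_integral_cmult)
    qed
    finally show ?thesis .
  qed
  have b1: "(\<integral>\<^sup>+z. b z \<partial>B) = 1"
    using b_rotate[of "\<lambda>_ _. 1"] by (simp add: c1 P.emeasure_space_1)
  have fin: "AE z in B. f z < \<infinity> \<and> b z < \<infinity>"
    using AE_finite_of_nn_integral_eq_1[OF f f1] AE_finite_of_nn_integral_eq_1[OF b b1] by auto
  have E_meas: "(\<lambda>\<omega>. E i (v \<omega>) (\<eta> \<omega>)) \<in> borel_measurable N"
    if "v \<in> measurable N (MX \<Otimes>\<^sub>M MR)" "\<And>j. j \<in> {1..K} \<Longrightarrow> (\<lambda>\<omega>. \<eta> \<omega> j) \<in> measurable N MY" "i \<in> {1..K}"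
    for i N v \<eta>
    unfolding E_def using that
    by (intro borel_measurable_nce_ratio[OF s[unfolded B_def]]) auto
  have own_meas: "own \<in> measurable B (MX \<Otimes>\<^sub>M MR)"
    unfolding own_def[abs_def] by measurable
  have y_meas: "(\<lambda>w. y w j) \<in> measurable W MY" if "j \<in> {1..K}" for j
  proof -
    have "(\<lambda>z. snd (fst z)) \<in> measurable P MY" by measurable
    from measurable_compose[OF comp[OF that] this] show ?thesis unfolding y_def .
  qed
  have UE_meas: "(\<lambda>w. E i (own (w i)) (y w)) \<in> borel_measurable W" if "i \<in> {1..K}" for i
    using measurable_compose[OF comp[OF that]] own_meas y_meas that
    by (intro E_meas) (simp_all add: setsP P_def)
  have U_meas: "U i \<in> borel_measurable W" if "i \<in> {1..K}" for i
    using UE_meas[OF that] unfolding U_def[abs_def] by measurable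
  have upd: "(\<lambda>(w, z). w(i := z)) \<in> measurable (W \<Otimes>\<^sub>M P) W" if "i \<in> {1..K}" for i
    using measurable_add_dim[of i "{1..K}" "\<lambda>_. P"] unfolding insert_absorb[OF that] W_def .
  \<comment> \<open>Exponential moment of summand \<open>i\<close>: anchor and candidate
    \<open>i\<close> come from a draw of the reference, the other candidates from the
    sample.\<close>
  define A where "A i = (\<integral>\<^sup>+w. (\<integral>\<^sup>+z. b z * ennreal (E i (own z) ((y w)(i := snd (fst z)))) \<partial>B) \<partial>W)" for i
  have step: "ennreal (ln (real K)) + 1 \<le> D + A i + (\<integral>\<^sup>+w. ennreal (U i w) \<partial>W)" if i: "i \<in> {1..K}" for i
  proof -
    have inner: "ennreal (ln (real K)) + 1
      \<le> D + (\<integral>\<^sup>+z. b z * ennreal (E i (own z) ((y w)(i := snd (fst z)))) \<partial>B)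
          + (\<integral>\<^sup>+z. ennreal (U i (w(i := z))) \<partial>P)" if w: "w \<in> space W" for w
    proof -
      have yw: "y w j \<in> space MY" if "j \<in> {1..K}" for j
        using measurable_space[OF y_meas[OF that] w] .
      have m1 [measurable]: "(\<lambda>z. E i (own z) ((y w)(i := snd (fst z)))) \<in> borel_measurable B"
      proof (intro E_meas own_meas i)
        fix j assume "j \<in> {1..K}"
        then show "(\<lambda>z. ((y w)(i := snd (fst z))) j) \<in> measurable B MY"
          using yw by (cases "j = i") auto
      qed
      have U_upd: "U i (w(i := z)) = ln (real K) - ln (E i (own z) ((y w)(i := snd (fst z))))" for z
        by (simp add: U_def y_upd)
      have m2 [measurable]: "(\<lambda>z. U i (w(i := z))) \<in> borel_measurable B"
        unfolding U_upd by measurable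
      \<comment> \<open>With \<open>k = ln K\<close> and \<open>u\<close> the deficit, the
        exponential in Young's inequality is exactly the ratio.\<close>
      have exp_U: "exp (ln (real K) - U i (w(i := z))) = E i (own z) ((y w)(i := snd (fst z)))" for z
        using E_bounds(1)[OF i] by (simp add: U_upd)
      have "(\<integral>\<^sup>+z. f z * ennreal (ln (real K)) + b z \<partial>B)
        \<le> (\<integral>\<^sup>+z. kl_term (f z) (b z) + b z * ennreal (E i (own z) ((y w)(i := snd (fst z))))
             + f z * ennreal (U i (w(i := z))) \<partial>B)"
      proof (rule nn_integral_mono_AE)
        show "AE z in B. f z * ennreal (ln (real K)) + b z
          \<le> kl_term (f z) (b z) + b z * ennreal (E i (own z) ((y w)(i := snd (fst z))))
             + f z * ennreal (U i (w(i := z)))"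
          using fin
        proof eventually_elim
          case (elim z)
          then show ?case
            using kl_term_variational[of "f z" "b z" "U i (w(i := z))" "ln (real K)"] U_nonneg[OF i] K
            by (simp add: exp_U)
        qed
      qed
      \<comment> \<open>Both densities have total mass one. The mass of \<open>b\<close> is the
        summand \<open>1\<close>, which will cancel against the exponential moments.\<close>
      moreover have "(\<integral>\<^sup>+z. f z * ennreal (ln (real K)) + b z \<partial>B) = ennreal (ln (real K)) + 1"
        by (simp add: nn_integral_add nn_integral_multc f1 b1)
      moreover have "(\<integral>\<^sup>+z. kl_term (f z) (b z) + b z * ennreal (E i (own z) ((y w)(i := snd (fst z))))
             + f z * ennreal (U i (w(i := z))) \<partial>B)
          = D + (\<integral>\<^sup>+z. b z * ennreal (E i (own z) ((y w)(i := snd (fst z)))) \<partial>B)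
          + (\<integral>\<^sup>+z. ennreal (U i (w(i := z))) \<partial>P)"
        unfolding P_def by (subst nn_integral_density) (simp_all add: nn_integral_add D_def)
      ultimately show ?thesis by simp
    qed
    have [measurable]: "(\<lambda>(w, z). U i (w(i := z))) \<in> borel_measurable (W \<Otimes>\<^sub>M P)"
      using measurable_compose[OF upd[OF i] U_meas[OF i]] by (simp add: split_beta')
    have "(\<lambda>(w, z). E i (own z) ((y w)(i := snd (fst z)))) \<in> borel_measurable (W \<Otimes>\<^sub>M P)"
      using measurable_compose[OF upd[OF i] UE_meas[OF i]] by (simp add: split_beta' y_upd)
    then have [measurable]: "(\<lambda>(w, z). E i (own z) ((y w)(i := snd (fst z)))) \<in> borel_measurable (W \<Otimes>\<^sub>M B)"
      by (simp add: P_def cong: measurable_cong_sets)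
    have "(\<integral>\<^sup>+w. ennreal (ln (real K)) + 1 \<partial>W)
      \<le> (\<integral>\<^sup>+w. D + (\<integral>\<^sup>+z. b z * ennreal (E i (own z) ((y w)(i := snd (fst z)))) \<partial>B)
          + (\<integral>\<^sup>+z. ennreal (U i (w(i := z))) \<partial>P) \<partial>W)"
      by (rule nn_integral_mono) (rule inner)
    also have "\<dots> = D + A i + (\<integral>\<^sup>+w. (\<integral>\<^sup>+z. ennreal (U i (w(i := z))) \<partial>P) \<partial>W)"
      by (simp add: nn_integral_add A_def W1)
    \<comment> \<open>The fresh triple has the law of coordinate \<open>i\<close>, so resampling
      removes it.\<close>
    also have "(\<integral>\<^sup>+w. (\<integral>\<^sup>+z. ennreal (U i (w(i := z))) \<partial>P) \<partial>W) = (\<integral>\<^sup>+w. ennreal (U i w) \<partial>W)"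
      using U_meas[OF i] by (intro W.nn_integral_PiM_resample[folded W_def] i) simp_all
    finally show ?thesis
      by (simp add: W1)
  qed
  have A_eq: "A i = (\<integral>\<^sup>+v. c v * (\<integral>\<^sup>+w. ennreal (E i v (y w)) \<partial>W) \<partial>(MX \<Otimes>\<^sub>M MR))" if i: "i \<in> {1..K}" for i
  proof -
    have [measurable]: "(\<lambda>\<omega>. E i (snd (fst \<omega>)) ((y (fst (fst \<omega>)))(i := snd (fst (snd \<omega>)))))
        \<in> borel_measurable ((W \<Otimes>\<^sub>M (MX \<Otimes>\<^sub>M MR)) \<Otimes>\<^sub>M P)"
    proof (intro E_meas i)
      fix j assume j: "j \<in> {1..K}"
      note y_meas[OF j, measurable]
      show "(\<lambda>\<omega>. ((y (fst (fst \<omega>)))(i := snd (fst (snd \<omega>)))) j)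
          \<in> measurable ((W \<Otimes>\<^sub>M (MX \<Otimes>\<^sub>M MR)) \<Otimes>\<^sub>M P) MY"
        by (cases "j = i") simp_all
    qed measurable
    \<comment> \<open>The anchor \<open>v\<close> is now separate from the fresh candidate. Once the
      integral over \<open>v\<close> is outermost, that candidate is just a resampled coordinate of
      \<open>w\<close>.\<close>
    have "A i = (\<integral>\<^sup>+w. (\<integral>\<^sup>+v. c v * (\<integral>\<^sup>+z. ennreal (E i v ((y w)(i := snd (fst z)))) \<partial>P) \<partial>(MX \<Otimes>\<^sub>M MR)) \<partial>W)"
      unfolding A_def
    proof (intro nn_integral_cong b_rotate)
      fix w assume w: "w \<in> space W"
      have "(\<lambda>\<omega>. E i (fst \<omega>) ((y w)(i := snd \<omega>))) \<in> borel_measurable ((MX \<Otimes>\<^sub>M MR) \<Otimes>\<^sub>M MY)"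
      proof (intro E_meas i)
        fix j assume "j \<in> {1..K}"
        then show "(\<lambda>\<omega>. ((y w)(i := snd \<omega>)) j) \<in> measurable ((MX \<Otimes>\<^sub>M MR) \<Otimes>\<^sub>M MY) MY"
          using measurable_space[OF y_meas w] by (cases "j = i") auto
      qed measurable
      then show "(\<lambda>(v, u). ennreal (E i v ((y w)(i := u)))) \<in> borel_measurable ((MX \<Otimes>\<^sub>M MR) \<Otimes>\<^sub>M MY)"
        by (simp add: split_beta')
    qed
    also have "\<dots> = (\<integral>\<^sup>+v. (\<integral>\<^sup>+w. c v * (\<integral>\<^sup>+z. ennreal (E i v ((y w)(i := snd (fst z)))) \<partial>P) \<partial>W) \<partial>(MX \<Otimes>\<^sub>M MR))"
      by (rule WV.Fubini'[symmetric]) measurable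
    also have "\<dots> = (\<integral>\<^sup>+v. c v * (\<integral>\<^sup>+w. ennreal (E i v (y w)) \<partial>W) \<partial>(MX \<Otimes>\<^sub>M MR))"
    proof (intro nn_integral_cong)
      fix v assume v: "v \<in> space (MX \<Otimes>\<^sub>M MR)"
      have F: "(\<lambda>w. ennreal (E i v (y w))) \<in> borel_measurable W"
        by (intro measurable_compose[OF _ measurable_ennreal] E_meas measurable_const v y_meas i)
      have "(\<lambda>w. \<integral>\<^sup>+z. ennreal (E i v ((y w)(i := snd (fst z)))) \<partial>P) \<in> borel_measurable W"
        using measurable_compose[OF upd[OF i] F]
        by (intro P.borel_measurable_nn_integral) (simp add: split_beta' y_upd)
      then have "(\<integral>\<^sup>+w. c v * (\<integral>\<^sup>+z. ennreal (E i v ((y w)(i := snd (fst z)))) \<partial>P) \<partial>W)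
        = c v * (\<integral>\<^sup>+w. (\<integral>\<^sup>+z. ennreal (E i v (y (w(i := z)))) \<partial>P) \<partial>W)"
        by (simp add: nn_integral_cmult y_upd)
      also have "(\<integral>\<^sup>+w. (\<integral>\<^sup>+z. ennreal (E i v (y (w(i := z)))) \<partial>P) \<partial>W) = (\<integral>\<^sup>+w. ennreal (E i v (y w)) \<partial>W)"
        by (intro W.nn_integral_PiM_resample[folded W_def] i F) simp
      finally show "(\<integral>\<^sup>+w. c v * (\<integral>\<^sup>+z. ennreal (E i v ((y w)(i := snd (fst z)))) \<partial>P) \<partial>W)
        = c v * (\<integral>\<^sup>+w. ennreal (E i v (y w)) \<partial>W)" .
    qed
    finally show ?thesis .
  qed
  have E_meas2: "(\<lambda>(v, w). E i v (y w)) \<in> borel_measurable ((MX \<Otimes>\<^sub>M MR) \<Otimes>\<^sub>M W)" if "i \<in> {1..K}" for i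
    unfolding split_beta' using that
    by (intro E_meas measurable_fst measurable_compose[OF measurable_snd y_meas])
  \<comment> \<open>Evaluating a single \<open>A i\<close> would call for exchangeability of the
    sample. The sum is simpler: at a common anchor its integrand is already constant.\<close>
  have "(\<Sum>i = 1..K. A i) = (\<integral>\<^sup>+v. (\<Sum>i = 1..K. c v * (\<integral>\<^sup>+w. ennreal (E i v (y w)) \<partial>W)) \<partial>(MX \<Otimes>\<^sub>M MR))"
  proof (subst nn_integral_sum)
    fix i assume i: "i \<in> {1..K}"
    note E_meas2[OF i, measurable]
    show "(\<lambda>v. c v * (\<integral>\<^sup>+w. ennreal (E i v (y w)) \<partial>W)) \<in> borel_measurable (MX \<Otimes>\<^sub>M MR)"
      by measurable
  qed (simp add: A_eq)
  also have "\<dots> = (\<integral>\<^sup>+v. c v * ennreal (real K) \<partial>(MX \<Otimes>\<^sub>M MR))"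
  proof (intro nn_integral_cong)
    fix v assume v: "v \<in> space (MX \<Otimes>\<^sub>M MR)"
    have "(\<Sum>i = 1..K. \<integral>\<^sup>+w. ennreal (E i v (y w)) \<partial>W) = (\<integral>\<^sup>+w. (\<Sum>i = 1..K. ennreal (E i v (y w))) \<partial>W)"
      by (intro nn_integral_sum[symmetric] measurable_compose[OF _ measurable_ennreal]
          E_meas measurable_const v y_meas)
    also have "\<dots> = (\<integral>\<^sup>+w. ennreal (real K) \<partial>W)"
    proof (intro nn_integral_cong)
      fix w
      have "(\<Sum>i = 1..K. ennreal (E i v (y w))) = ennreal (\<Sum>i = 1..K. E i v (y w))"
        using less_imp_le[OF E_bounds(1)] by (intro sum_ennreal)
      then show "(\<Sum>i = 1..K. ennreal (E i v (y w))) = ennreal (real K)"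
        using K by (simp only: E_def sum_nce_ratio)
    qed
    also have "\<dots> = ennreal (real K)"
      by (simp add: W1)
    finally show "(\<Sum>i = 1..K. c v * (\<integral>\<^sup>+w. ennreal (E i v (y w)) \<partial>W)) = c v * ennreal (real K)"
      by (simp flip: sum_distrib_left)
  qed
  also have "\<dots> = ennreal (real K)"
    by (simp add: nn_integral_multc c1)
  finally have sum_A: "(\<Sum>i = 1..K. A i) = ennreal (real K)" .
  define V where "V w = 1 / real K * (\<Sum>i = 1..K. U i w)" for w
  have V_nonneg: "V w \<ge> 0" for w
    unfolding V_def using U_nonneg by (intro mult_nonneg_nonneg sum_nonneg) auto
  have V_meas: "V \<in> borel_measurable W"
    unfolding V_def[abs_def] using U_meas by (intro borel_measurable_times borel_measurable_sum) auto
  have int_V: "(\<integral>\<^sup>+w. ennreal (V w) \<partial>W) = ennreal (1 / real K) * (\<Sum>i = 1..K. \<integral>\<^sup>+w. ennreal (U i w) \<partial>W)"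
  proof -
    have "ennreal (V w) = ennreal (1 / real K) * (\<Sum>i = 1..K. ennreal (U i w))" for w
    proof -
      have "(\<Sum>i = 1..K. ennreal (U i w)) = ennreal (\<Sum>i = 1..K. U i w)"
        by (intro sum_ennreal U_nonneg)
      then show ?thesis
        unfolding V_def by (subst ennreal_mult) (auto intro!: sum_nonneg U_nonneg simp del: One_nat_def)
    qed
    moreover have "(\<integral>\<^sup>+w. (\<Sum>i = 1..K. ennreal (U i w)) \<partial>W) = (\<Sum>i = 1..K. \<integral>\<^sup>+w. ennreal (U i w) \<partial>W)"
      by (intro nn_integral_sum measurable_compose[OF U_meas measurable_ennreal])
    ultimately show ?thesis
      using U_meas by (simp add: nn_integral_cmult del: One_nat_def)
  qed
  \<comment> \<open>The K masses of \<open>b\<close> on the left meet \<open>sum_A\<close> on the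
    right; being finite, they cancel even if \<open>D\<close> is infinite.\<close>
  have sum_le: "ennreal (real K) * ennreal (ln (real K)) \<le> ennreal (real K) * D + (\<Sum>i = 1..K. \<integral>\<^sup>+w. ennreal (U i w) \<partial>W)"
  proof -
    have const: "(\<Sum>i = 1..K. t) = ennreal (real K) * t" for t
      by (simp add: ennreal_of_nat_eq_real_of_nat)
    have "(\<Sum>i = 1..K. ennreal (ln (real K)) + 1) \<le> (\<Sum>i = 1..K. D + A i + (\<integral>\<^sup>+w. ennreal (U i w) \<partial>W))"
      using step by (intro sum_mono) auto
    then have "ennreal (real K) * ennreal (ln (real K)) + ennreal (real K)
      \<le> ennreal (real K) * D + ennreal (real K) + (\<Sum>i = 1..K. \<integral>\<^sup>+w. ennreal (U i w) \<partial>W)"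
      by (simp only: sum.distrib sum_A const distrib_left mult_1_right)
    then have "ennreal (real K) + ennreal (real K) * ennreal (ln (real K))
      \<le> ennreal (real K) + (ennreal (real K) * D + (\<Sum>i = 1..K. \<integral>\<^sup>+w. ennreal (U i w) \<partial>W))"
      by (simp add: ac_simps)
    then show ?thesis
      by (simp add: ennreal_add_left_cancel_le)
  qed
  have le: "ennreal (ln (real K)) \<le> D + (\<integral>\<^sup>+w. ennreal (V w) \<partial>W)"
  proof -
    have cancel: "ennreal (1 / real K) * (ennreal (real K) * t) = t" for t
      using K by (simp add: mult.assoc[symmetric] flip: ennreal_mult)
    show ?thesis
      using mult_left_mono[OF sum_le, of "ennreal (1 / real K)"]
      by (simp only: cancel distrib_left int_V) simp
  qed
  have integrand: "(\<lambda>w. let x = (\<lambda>i. fst (fst (w i))); y = (\<lambda>i. snd (fst (w i))); r = (\<lambda>i. snd (w i)) in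
      1 / real K * (\<Sum>i = 1..K. ln (exp (s (x i) (y i) (r i) / \<tau>) /
        (1 / real K * (\<Sum>j = 1..K. exp (s (x i) (y j) (r i) / \<tau>)))))) = (\<lambda>w. ln (real K) - V w)"
  proof
    fix w
    have "ln (real K) - V w = 1 / real K * (\<Sum>i = 1..K. ln (E i (own (w i)) (y w)))"
      using K by (simp add: V_def U_def sum_subtractf right_diff_distrib)
    then show "(let x = (\<lambda>i. fst (fst (w i))); y = (\<lambda>i. snd (fst (w i))); r = (\<lambda>i. snd (w i)) in
      1 / real K * (\<Sum>i = 1..K. ln (exp (s (x i) (y i) (r i) / \<tau>) /
        (1 / real K * (\<Sum>j = 1..K. exp (s (x i) (y j) (r i) / \<tau>)))))) = ln (real K) - V w"
      by (simp add: E_def nce_ratio_def own_def y_def Let_def)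
  qed
  \<comment> \<open>If \<open>D\<close> exceeds ln K, the ceiling alone gives the inequality. The
    minimum keeps a finite bound when \<open>D\<close> is infinite.\<close>
  have "ennreal (ln (real K)) \<le> min (ennreal (ln (real K))) D + (\<integral>\<^sup>+w. ennreal (V w) \<partial>W)"
    using le by (simp add: min_def)
  then have "ext_expectation W (\<lambda>w. ln (real K) - V w) \<le> enn2ereal (min (ennreal (ln (real K))) D)"
    using V_meas V_nonneg K by (intro W.P.ext_expectation_le[folded W_def]) simp_all
  then show ?thesis
    unfolding infoNCE_loss_def integrand by (simp add: W_def P_def D_def b_def)
qed

text \<open>The finite bound \<open>k\<close> excludes \<open>\<infinity> - \<infinity> = \<infinity>\<close> on the left.\<close>

lemma ereal_diff_le_of_le_min:
  assumes "N \<le> enn2ereal (min (ennreal k) (I + R))"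
  shows "N - enn2ereal R \<le> enn2ereal I"
proof -
  have "enn2ereal (min (ennreal k) (I + R)) \<le> enn2ereal (ennreal k)"
    and "enn2ereal (min (ennreal k) (I + R)) \<le> enn2ereal (I + R)"
    unfolding less_eq_ennreal.rep_eq[symmetric] by simp_all
  with assms have N: "N \<le> enn2ereal (ennreal k)" "N \<le> enn2ereal I + enn2ereal R"
    unfolding plus_ennreal.rep_eq by (auto intro: order_trans)
  show ?thesis
  proof (cases "R = \<infinity>")
    case True
    with N(1) show ?thesis by (cases N) auto
  next
    case False
    with N(2) show ?thesis
      by (cases R; cases I; cases N) (auto simp: enn2ereal_ennreal)
  qed
qed

section \<open>Joint law with a variational density and a conditional prior\<close>

text \<open>\<open>q1\<close> and \<open>prior1\<close> are the normalisations almost everywhere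
  under the laws of (x, y) and of x, rewritten in terms of the reference measures: where those laws
  have density zero, the conditional densities are arbitrary.\<close>

locale conditional_prior =
  fixes MX :: "'x measure" and MY :: "'y measure" and MR :: "'r measure"
    and p :: "'x \<times> 'y \<Rightarrow> ennreal" and q :: "'x \<times> 'y \<Rightarrow> 'r \<Rightarrow> ennreal"
    and prior :: "'x \<Rightarrow> 'r \<Rightarrow> ennreal"
  assumes sf: "sigma_finite_measure MX" "sigma_finite_measure MY" "sigma_finite_measure MR"
    and p [measurable]: "p \<in> borel_measurable (MX \<Otimes>\<^sub>M MY)"
    and p1: "(\<integral>\<^sup>+z. p z \<partial>(MX \<Otimes>\<^sub>M MY)) = 1"
    and q [measurable]: "(\<lambda>(z, r). q z r) \<in> borel_measurable ((MX \<Otimes>\<^sub>M MY) \<Otimes>\<^sub>M MR)"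
    and q1: "AE z in MX \<Otimes>\<^sub>M MY. p z \<noteq> 0 \<longrightarrow> (\<integral>\<^sup>+r. q z r \<partial>MR) = 1"
    and prior [measurable]: "(\<lambda>(x, r). prior x r) \<in> borel_measurable (MX \<Otimes>\<^sub>M MR)"
    and prior1: "AE x in MX. (\<integral>\<^sup>+y. p (x, y) \<partial>MY) \<noteq> 0 \<longrightarrow> (\<integral>\<^sup>+r. prior x r \<partial>MR) = 1"
begin

sublocale X: sigma_finite_measure MX by (rule sf)
sublocale Y: sigma_finite_measure MY by (rule sf)
sublocale R: sigma_finite_measure MR by (rule sf)
sublocale XY: pair_sigma_finite MX MY ..
sublocale XR: pair_sigma_finite MX MR ..
sublocale YR: pair_sigma_finite MY MR ..
sublocale RY: pair_sigma_finite MR MY ..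
sublocale B: pair_sigma_finite "MX \<Otimes>\<^sub>M MY" MR ..

definition pX :: "'x \<Rightarrow> ennreal" where "pX x = (\<integral>\<^sup>+y. p (x, y) \<partial>MY)"

definition pY :: "'y \<Rightarrow> ennreal" where "pY y = (\<integral>\<^sup>+x. p (x, y) \<partial>MX)"

lemmas AE_prior = prior1[folded pX_def]

lemma pX [measurable]: "pX \<in> borel_measurable MX"
  unfolding pX_def[abs_def] by measurable

lemma pY [measurable]: "pY \<in> borel_measurable MY"
  unfolding pY_def[abs_def] by measurable

lemma nn_integral_pX: "(\<integral>\<^sup>+x. pX x \<partial>MX) = 1"
  unfolding pX_def using p1 by (simp add: Y.nn_integral_fst)

lemma nn_integral_pY: "(\<integral>\<^sup>+y. pY y \<partial>MY) = 1"
  unfolding pY_def using p1 by (simp add: XY.nn_integral_snd)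

lemma nn_integral_q: "AE z in MX \<Otimes>\<^sub>M MY. p z * (\<integral>\<^sup>+r. q z r \<partial>MR) = p z"
  using q1 by eventually_elim auto

lemma nn_integral_pX_pY: "(\<integral>\<^sup>+z. pX (fst z) * pY (snd z) \<partial>(MX \<Otimes>\<^sub>M MY)) = 1"
  by (subst Y.nn_integral_fst[symmetric]) (simp_all add: nn_integral_cmult nn_integral_pX nn_integral_pY)

text \<open>A fibre of \<open>p\<close> with integral zero vanishes for almost every
  \<open>y\<close>. This carries the normalisation of \<open>prior\<close>, known where
  \<open>pX\<close> is nonzero, over to the points where \<open>p\<close> is nonzero.\<close>

lemma AE_pX_nonzero: "AE z in MX \<Otimes>\<^sub>M MY. p z \<noteq> 0 \<longrightarrow> pX (fst z) \<noteq> 0"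
proof (rule XY.AE_pair_measure)
  show "{z \<in> space (MX \<Otimes>\<^sub>M MY). p z \<noteq> 0 \<longrightarrow> pX (fst z) \<noteq> 0} \<in> sets (MX \<Otimes>\<^sub>M MY)"
    by measurable
  show "AE x in MX. AE y in MY. p (x, y) \<noteq> 0 \<longrightarrow> pX (fst (x, y)) \<noteq> 0"
  proof (rule AE_I2)
    fix x assume "x \<in> space MX"
    then have "(\<lambda>y. p (x, y)) \<in> borel_measurable MY" by simp
    then show "AE y in MY. p (x, y) \<noteq> 0 \<longrightarrow> pX (fst (x, y)) \<noteq> 0"
      by (cases "pX x = 0") (auto simp: pX_def nn_integral_0_iff_AE)
  qed
qed

lemma AE_nn_integral_prior:
  "AE z in MX \<Otimes>\<^sub>M MY. pX (fst z) \<noteq> 0 \<longrightarrow> (\<integral>\<^sup>+r. prior (fst z) r \<partial>MR) = 1"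
proof (rule XY.AE_pair_measure)
  show "{z \<in> space (MX \<Otimes>\<^sub>M MY). pX (fst z) \<noteq> 0 \<longrightarrow> (\<integral>\<^sup>+r. prior (fst z) r \<partial>MR) = 1}
      \<in> sets (MX \<Otimes>\<^sub>M MY)"
    by measurable
qed (use AE_prior in auto)

lemma reg_loss_eq:
  "reg_loss (density (MX \<Otimes>\<^sub>M MY) p) MR q prior
    = (\<integral>\<^sup>+z. p z * (\<integral>\<^sup>+r. kl_term (q z r) (prior (fst z) r) \<partial>MR) \<partial>(MX \<Otimes>\<^sub>M MY))"
proof -
  have "AE z in density (MX \<Otimes>\<^sub>M MY) p. KL (density MR (q z)) (density MR (prior (fst z)))
      = (\<integral>\<^sup>+r. kl_term (q z r) (prior (fst z) r) \<partial>MR)"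
    unfolding AE_density[OF p]
    using q1 AE_pX_nonzero AE_nn_integral_prior AE_space
  proof eventually_elim
    case (elim z)
    then show ?case
      using measurable_Pair2[OF q, of z] measurable_Pair2[OF prior, of "fst z"]
      by (auto intro!: KL_eq_nn_integral_kl_term simp: space_pair_measure)
  qed
  then have "reg_loss (density (MX \<Otimes>\<^sub>M MY) p) MR q prior
      = (\<integral>\<^sup>+z. (\<integral>\<^sup>+r. kl_term (q z r) (prior (fst z) r) \<partial>MR) \<partial>density (MX \<Otimes>\<^sub>M MY) p)"
    unfolding reg_loss_def split_beta' by (intro nn_integral_cong_AE) simp
  then show ?thesis
    by (simp add: nn_integral_density)
qed

lemma marginal_density_joint_density:
  "AE x in MX. marginal_density MY MR (joint_density p q) x = pX x"
  using XY.AE_pair[OF nn_integral_q] AE_space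
proof eventually_elim
  case (elim x)
  have "marginal_density MY MR (joint_density p q) x
      = (\<integral>\<^sup>+y. (\<integral>\<^sup>+r. p (x, y) * q (x, y) r \<partial>MR) \<partial>MY)"
    unfolding marginal_density_def joint_density_def using elim(2)
    by (subst R.nn_integral_fst[symmetric]) (simp_all add: split_beta')
  also have "\<dots> = (\<integral>\<^sup>+y. p (x, y) * (\<integral>\<^sup>+r. q (x, y) r \<partial>MR) \<partial>MY)"
    using elim(2) by (intro nn_integral_cong nn_integral_cmult) simp
  also have "\<dots> = pX x"
    unfolding pX_def using elim(1) by (intro nn_integral_cong_AE) simp
  finally show ?case .
qed

section \<open>Conditional mutual information against the prior\<close>

text \<open>Given \<open>x\<close>, the density of \<open>r\<close> at each point is the mean over
  \<open>y\<close> of the densities \<open>q (x, y)\<close> there, so the averaging inequality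
  applies separately for every \<open>r\<close>. The factor \<open>m\<close> turns the conditional
  density of \<open>y\<close> back into \<open>p (x, y)\<close>.\<close>

lemma mutual_info_cond_law_le:
  assumes x [measurable]: "x \<in> space MX"
    and m: "m = marginal_density MY MR (joint_density p q) x" "m = pX x" "m \<noteq> 0" "m < \<infinity>"
    and qx: "AE y in MY. p (x, y) \<noteq> 0 \<longrightarrow> (\<integral>\<^sup>+r. q (x, y) r \<partial>MR) = 1"
    and px: "AE y in MY. p (x, y) < \<infinity>"
    and priorx: "(\<integral>\<^sup>+r. prior x r \<partial>MR) = 1"
  shows "m * mutual_info (cond_law MY MR (joint_density p q) x) MR MY snd fst
    \<le> (\<integral>\<^sup>+y. p (x, y) * (\<integral>\<^sup>+r. kl_term (q (x, y) r) (prior x r) \<partial>MR) \<partial>MY)"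
proof -
  define w where "w y = p (x, y) / m" for y
  define k where "k y r = q (x, y) r" for y r
  have pm [measurable]: "(\<lambda>y. p (x, y)) \<in> borel_measurable MY" by simp
  have w [measurable]: "w \<in> borel_measurable MY" unfolding w_def[abs_def] by measurable
  have k [measurable]: "(\<lambda>(y, r). k y r) \<in> borel_measurable (MY \<Otimes>\<^sub>M MR)"
    unfolding k_def by measurable
  have pr [measurable]: "prior x \<in> borel_measurable MR"
    using measurable_Pair2[OF prior x] by simp
  have mw: "m * w y = p (x, y)" for y
    using m(3,4)
    by (simp add: w_def ennreal_times_divide mult.commute[of m] mult_divide_eq_ennreal less_top)
  have w1: "(\<integral>\<^sup>+y. w y \<partial>MY) = 1"
    using m unfolding w_def by (subst nn_integral_divide) (auto simp: pX_def ennreal_divide_self)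
  interpret Pw: prob_space "density MY w"
    by (rule prob_spaceI) (simp add: emeasure_density w1 cong: nn_integral_cong)
  have wk: "AE y in MY. w y * (\<integral>\<^sup>+r. k y r \<partial>MR) = w y"
    using qx by eventually_elim (auto simp: w_def k_def)
  have wfin: "AE y in MY. w y < \<infinity>"
    using w1 by (intro AE_finite_of_nn_integral_eq_1) auto
  define g where "g = (\<lambda>(y, r). w y * k y r)"
  have g [measurable]: "g \<in> borel_measurable (MY \<Otimes>\<^sub>M MR)" unfolding g_def by measurable
  define C where "C = density (MY \<Otimes>\<^sub>M MR) g"
  have C: "cond_law MY MR (joint_density p q) x = C"
    unfolding cond_law_def m(1)[symmetric] unfolding C_def g_def joint_density_def w_def k_def
    by (simp add: ennreal_times_divide mult.commute split_beta')
  have int_g: "AE y in MY. (\<integral>\<^sup>+r. g (y, r) \<partial>MR) = w y"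
    using wk AE_space by eventually_elim (simp add: g_def nn_integral_cmult)
  have g1: "(\<integral>\<^sup>+z. g z \<partial>(MY \<Otimes>\<^sub>M MR)) = 1"
    using nn_integral_cong_AE[OF int_g] by (simp add: w1 R.nn_integral_fst)
  interpret C: prob_space C
    by (rule prob_spaceI) (simp add: C_def emeasure_density g1 cong: nn_integral_cong)
  have "distributed C (MY \<Otimes>\<^sub>M MR) (\<lambda>\<omega>. (fst \<omega>, snd \<omega>)) g"
    unfolding distributed_def by (simp add: C_def distr_id2)
  then have dist: "distributed C (MR \<Otimes>\<^sub>M MY) (\<lambda>\<omega>. (snd \<omega>, fst \<omega>)) (\<lambda>(r, y). g (y, r))"
    by (rule C.distributed_swap[OF sf(2,3)])
  \<comment> \<open>The conditional density of \<open>r\<close> given \<open>x\<close> that the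
    joint density induces.\<close>
  define mean where "mean r = (\<integral>\<^sup>+y. g (y, r) \<partial>MY)" for r
  have mean [measurable]: "mean \<in> borel_measurable MR" unfolding mean_def[abs_def] by measurable
  have mean_dens: "mean r = (\<integral>\<^sup>+y. k y r \<partial>density MY w)" if "r \<in> space MR" for r
    using that by (simp add: mean_def g_def nn_integral_density)
  have mean1: "(\<integral>\<^sup>+r. mean r \<partial>MR) = 1"
    unfolding mean_def using g1 RY.nn_integral_snd 
    by (subst RY.Fubini'[symmetric]) (simp_all add: R.nn_integral_fst)
  have prior_fin: "AE r in MR. prior x r < \<infinity>"
    using priorx by (intro AE_finite_of_nn_integral_eq_1) auto
  have "mutual_info (cond_law MY MR (joint_density p q) x) MR MY snd fst
    = (\<integral>\<^sup>+z. kl_term (g (snd z, fst z)) ((\<integral>\<^sup>+y. g (y, fst z) \<partial>MY) * (\<integral>\<^sup>+r. g (snd z, r) \<partial>MR)) \<partial>(MR \<Otimes>\<^sub>M MY))"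
    unfolding C using C.mutual_info_distributed[OF sf(3,2) dist] by (simp add: split_beta')
  also have "\<dots> = (\<integral>\<^sup>+r. (\<integral>\<^sup>+y. kl_term (g (y, r)) (mean r * (\<integral>\<^sup>+r. g (y, r) \<partial>MR)) \<partial>MY) \<partial>MR)"
    by (subst Y.nn_integral_fst[symmetric]) (simp_all add: mean_def)
  also have "\<dots> \<le> (\<integral>\<^sup>+r. (\<integral>\<^sup>+y. w y * kl_term (k y r) (prior x r) \<partial>MY) \<partial>MR)"
  proof (rule nn_integral_mono_AE)
    show "AE r in MR. (\<integral>\<^sup>+y. kl_term (g (y, r)) (mean r * (\<integral>\<^sup>+r. g (y, r) \<partial>MR)) \<partial>MY)
        \<le> (\<integral>\<^sup>+y. w y * kl_term (k y r) (prior x r) \<partial>MY)"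
      using AE_finite_of_nn_integral_eq_1[OF mean mean1] prior_fin AE_space
    proof eventually_elim
      case (elim r)
      note r = elim(3)
      have kr [measurable]: "(\<lambda>y. k y r) \<in> borel_measurable MY"
        using r by measurable
      have "AE y in MY. w y * k y r < \<infinity>"
        using elim(1) nn_integral_noteq_infinite[of "\<lambda>y. g (y, r)" MY] r
        by (auto simp: mean_def g_def less_top)
      \<comment> \<open>\<open>w y\<close> is a factor of both densities and moves into the measure
        by homogeneity. Where it vanishes, \<open>k y r\<close> may be infinite, but both sides are
        zero.\<close>
      with int_g wfin
      have "AE y in MY. kl_term (g (y, r)) (mean r * (\<integral>\<^sup>+r. g (y, r) \<partial>MR)) = w y * kl_term (k y r) (mean r)"
      proof eventually_elim
        case (elim y)
        show ?case
        proof (cases "w y = 0")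
          case True
          with elim show ?thesis by (simp add: g_def)
        next
          case False
          with elim have "k y r < \<infinity>"
            by (auto simp: ennreal_mult_less_top less_top)
          then show ?thesis
            using elim \<open>mean r < \<infinity>\<close>
            by (simp add: g_def mult.commute[of "mean r"] kl_term_mult)
        qed
      qed
      then have "(\<integral>\<^sup>+y. kl_term (g (y, r)) (mean r * (\<integral>\<^sup>+r. g (y, r) \<partial>MR)) \<partial>MY)
          = (\<integral>\<^sup>+y. kl_term (k y r) (mean r) \<partial>density MY w)"
        by (simp add: nn_integral_density cong: nn_integral_cong_AE)
      also have "\<dots> \<le> (\<integral>\<^sup>+y. kl_term (k y r) (prior x r) \<partial>density MY w)"
        using elim(1,2) unfolding mean_dens[OF r]
        by (intro Pw.nn_integral_kl_term_mean_le) simp_all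
      also have "\<dots> = (\<integral>\<^sup>+y. w y * kl_term (k y r) (prior x r) \<partial>MY)"
        by (simp add: nn_integral_density)
      finally show ?case .
    qed
  qed
  also have "\<dots> = (\<integral>\<^sup>+y. (\<integral>\<^sup>+r. w y * kl_term (k y r) (prior x r) \<partial>MR) \<partial>MY)"
    by (rule RY.Fubini'[symmetric]) measurable
  also have "\<dots> = (\<integral>\<^sup>+y. w y * (\<integral>\<^sup>+r. kl_term (k y r) (prior x r) \<partial>MR) \<partial>MY)"
    by (intro nn_integral_cong nn_integral_cmult) measurable
  finally have "m * mutual_info (cond_law MY MR (joint_density p q) x) MR MY snd fst
    \<le> m * (\<integral>\<^sup>+y. w y * (\<integral>\<^sup>+r. kl_term (k y r) (prior x r) \<partial>MR) \<partial>MY)"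
    by (rule mult_left_mono) simp
  also have "\<dots> = (\<integral>\<^sup>+y. p (x, y) * (\<integral>\<^sup>+r. kl_term (k y r) (prior x r) \<partial>MR) \<partial>MY)"
    by (subst nn_integral_cmult[symmetric]) (simp_all add: mw mult.assoc[symmetric])
  finally show ?thesis by (simp add: k_def)
qed

lemma cond_mutual_info_le_reg_loss:
  "cond_mutual_info MX MY MR (joint_density p q) \<le> reg_loss (density (MX \<Otimes>\<^sub>M MY) p) MR q prior"
proof -
  define R where "R x = (\<integral>\<^sup>+y. p (x, y) * (\<integral>\<^sup>+r. kl_term (q (x, y) r) (prior x r) \<partial>MR) \<partial>MY)" for x
  have R [measurable]: "R \<in> borel_measurable MX"
    unfolding R_def[abs_def] by measurable
  have eq: "density MX (marginal_density MY MR (joint_density p q)) = density MX pX"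
    using marginal_density_joint_density 
    by (intro density_cong) (auto simp: marginal_density_def[abs_def] joint_density_def split_beta')
  have p_fin: "AE x in MX. AE y in MY. p (x, y) < \<infinity>"
    using XY.AE_pair[OF AE_finite_of_nn_integral_eq_1[OF p p1]] by simp
  \<comment> \<open>The bound is taken under the law of x, before the density is unfolded: unfolding
    it requires a measurable integrand, which is at hand for \<open>R x / pX x\<close>, while
    measurability of the mutual information in x is not established.\<close>
  have "AE x in density MX pX. mutual_info (cond_law MY MR (joint_density p q) x) MR MY snd fst \<le> R x / pX x"
    unfolding AE_density[OF pX]
    using marginal_density_joint_density AE_finite_of_nn_integral_eq_1[OF pX nn_integral_pX]
      XY.AE_pair[OF q1] p_fin AE_prior AE_space
  proof eventually_elim
    case (elim x)
    show ?case
    proof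
      assume "0 < pX x"
      then have "pX x * mutual_info (cond_law MY MR (joint_density p q) x) MR MY snd fst \<le> R x"
        unfolding R_def using elim by (intro mutual_info_cond_law_le) auto
      then have "pX x * mutual_info (cond_law MY MR (joint_density p q) x) MR MY snd fst / pX x \<le> R x / pX x"
        by (rule divide_right_mono_ennreal)
      then show "mutual_info (cond_law MY MR (joint_density p q) x) MR MY snd fst \<le> R x / pX x"
        using \<open>0 < pX x\<close> elim(2) by (simp add: mult.commute[of "pX x"] mult_divide_eq_ennreal less_top)
    qed
  qed
  then have "cond_mutual_info MX MY MR (joint_density p q) \<le> (\<integral>\<^sup>+x. R x / pX x \<partial>density MX pX)"
    unfolding cond_mutual_info_def eq by (rule nn_integral_mono_AE)
  also have "\<dots> = (\<integral>\<^sup>+x. pX x * (R x / pX x) \<partial>MX)"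
    by (simp add: nn_integral_density)
  also have "\<dots> \<le> (\<integral>\<^sup>+x. R x \<partial>MX)"
  proof (rule nn_integral_mono_AE)
    show "AE x in MX. pX x * (R x / pX x) \<le> R x"
      using AE_finite_of_nn_integral_eq_1[OF pX nn_integral_pX]
    proof eventually_elim
      case (elim x)
      then show ?case
        by (cases "pX x = 0")
          (auto simp: ennreal_times_divide mult.commute[of "pX x"] mult_divide_eq_ennreal less_top)
    qed
  qed
  also have "\<dots> = reg_loss (density (MX \<Otimes>\<^sub>M MY) p) MR q prior"
    unfolding reg_loss_eq R_def by (subst Y.nn_integral_fst[symmetric]) simp_all
  finally show ?thesis .
qed

section \<open>Chain rule for the joint law and the final bounds\<close>

text \<open>Regrouping the reference as \<open>pX * pY\<close> times \<open>prior\<close> makes (x,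
  y) the conditioning variable, and the chain rule applies for almost every (x, y).\<close>

lemma kl_term_joint_density:
  "(\<integral>\<^sup>+z. kl_term (joint_density p q z)
      (pX (fst (fst z)) * prior (fst (fst z)) (snd z) * pY (snd (fst z))) \<partial>((MX \<Otimes>\<^sub>M MY) \<Otimes>\<^sub>M MR))
    = (\<integral>\<^sup>+z. kl_term (p z) (pX (fst z) * pY (snd z)) \<partial>(MX \<Otimes>\<^sub>M MY))
      + reg_loss (density (MX \<Otimes>\<^sub>M MY) p) MR q prior"
proof -
  have "(\<integral>\<^sup>+z. kl_term (joint_density p q z)
      (pX (fst (fst z)) * prior (fst (fst z)) (snd z) * pY (snd (fst z))) \<partial>((MX \<Otimes>\<^sub>M MY) \<Otimes>\<^sub>M MR))
    = (\<integral>\<^sup>+z. (\<integral>\<^sup>+r. kl_term (p z * q z r) (pX (fst z) * pY (snd z) * prior (fst z) r) \<partial>MR) \<partial>(MX \<Otimes>\<^sub>M MY))"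
    unfolding joint_density_def split_beta'
    by (subst R.nn_integral_fst[symmetric]) (simp_all add: mult.assoc mult.commute[of "prior _ _"])
  also have "\<dots> = (\<integral>\<^sup>+z. kl_term (p z) (pX (fst z) * pY (snd z))
      + p z * (\<integral>\<^sup>+r. kl_term (q z r) (prior (fst z) r) \<partial>MR) \<partial>(MX \<Otimes>\<^sub>M MY))"
  proof (rule nn_integral_cong_AE)
    have "AE z in MX \<Otimes>\<^sub>M MY. pX (fst z) * pY (snd z) < \<infinity>"
      by (rule AE_finite_of_nn_integral_eq_1[OF _ nn_integral_pX_pY]) measurable
    then show "AE z in MX \<Otimes>\<^sub>M MY.
        (\<integral>\<^sup>+r. kl_term (p z * q z r) (pX (fst z) * pY (snd z) * prior (fst z) r) \<partial>MR)
        = kl_term (p z) (pX (fst z) * pY (snd z)) + p z * (\<integral>\<^sup>+r. kl_term (q z r) (prior (fst z) r) \<partial>MR)"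
      using AE_finite_of_nn_integral_eq_1[OF p p1] q1 AE_pX_nonzero AE_nn_integral_prior AE_space
    proof eventually_elim
      case (elim z)
      have "q z \<in> borel_measurable MR" "prior (fst z) \<in> borel_measurable MR"
        using measurable_Pair2[OF q, of z] measurable_Pair2[OF prior, of "fst z"] elim(6)
        by (auto simp: space_pair_measure)
      then show ?case
        using elim by (intro nn_integral_kl_term_chain) auto
    qed
  qed
  also have "\<dots> = (\<integral>\<^sup>+z. kl_term (p z) (pX (fst z) * pY (snd z)) \<partial>(MX \<Otimes>\<^sub>M MY))
      + reg_loss (density (MX \<Otimes>\<^sub>M MY) p) MR q prior"
    unfolding reg_loss_eq by (rule nn_integral_add) measurable
  finally show ?thesis .
qed

lemma joint_density [measurable]: "joint_density p q \<in> borel_measurable ((MX \<Otimes>\<^sub>M MY) \<Otimes>\<^sub>M MR)"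
  unfolding joint_density_def by measurable

lemma nn_integral_joint_density:
  assumes [measurable]: "T \<in> borel_measurable (MX \<Otimes>\<^sub>M MY)"
  shows "(\<integral>\<^sup>+z. joint_density p q z * T (fst z) \<partial>((MX \<Otimes>\<^sub>M MY) \<Otimes>\<^sub>M MR)) = (\<integral>\<^sup>+z. p z * T z \<partial>(MX \<Otimes>\<^sub>M MY))"
proof -
  have "(\<integral>\<^sup>+z. joint_density p q z * T (fst z) \<partial>((MX \<Otimes>\<^sub>M MY) \<Otimes>\<^sub>M MR))
    = (\<integral>\<^sup>+z. (\<integral>\<^sup>+r. T z * p z * q z r \<partial>MR) \<partial>(MX \<Otimes>\<^sub>M MY))"
    unfolding joint_density_def split_beta'
    by (subst R.nn_integral_fst[symmetric]) (simp_all add: mult_ac)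
  also have "\<dots> = (\<integral>\<^sup>+z. T z * (p z * (\<integral>\<^sup>+r. q z r \<partial>MR)) \<partial>(MX \<Otimes>\<^sub>M MY))"
    by (intro nn_integral_cong) (simp add: nn_integral_cmult mult.assoc)
  also have "\<dots> = (\<integral>\<^sup>+z. p z * T z \<partial>(MX \<Otimes>\<^sub>M MY))"
    using nn_integral_q by (intro nn_integral_cong_AE) (auto simp: mult.commute)
  finally show ?thesis .
qed

text \<open>Here \<open>c\<close> is \<open>pX\<close> times \<open>prior\<close>, which may differ
  from the (x, r)-marginal of the joint density: the contrastive bound asks of \<open>c\<close> only
  measurability and total mass one. The \<open>y\<close>-marginal is still \<open>pY\<close>,
  because \<open>q\<close> integrates to one over \<open>r\<close>.\<close>

lemma infoNCE_le_mutual_info: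
  assumes s: "(\<lambda>((x, y), r). s x y r) \<in> borel_measurable ((MX \<Otimes>\<^sub>M MY) \<Otimes>\<^sub>M MR)" and K: "K \<ge> 1"
  shows "- infoNCE_loss (density ((MX \<Otimes>\<^sub>M MY) \<Otimes>\<^sub>M MR) (joint_density p q)) s \<tau> K
    \<le> enn2ereal (min (ennreal (ln (real K)))
        ((\<integral>\<^sup>+z. kl_term (p z) (pX (fst z) * pY (snd z)) \<partial>(MX \<Otimes>\<^sub>M MY))
          + reg_loss (density (MX \<Otimes>\<^sub>M MY) p) MR q prior))"
proof -
  have "(\<integral>\<^sup>+z. joint_density p q z \<partial>((MX \<Otimes>\<^sub>M MY) \<Otimes>\<^sub>M MR)) = 1"
    using nn_integral_joint_density[of "\<lambda>_. 1"] p1 by simp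
  moreover have "(\<integral>\<^sup>+v. pX (fst v) * prior (fst v) (snd v) \<partial>(MX \<Otimes>\<^sub>M MR)) = 1"
  proof -
    have "(\<integral>\<^sup>+v. pX (fst v) * prior (fst v) (snd v) \<partial>(MX \<Otimes>\<^sub>M MR))
      = (\<integral>\<^sup>+x. pX x * (\<integral>\<^sup>+r. prior x r \<partial>MR) \<partial>MX)"
      by (subst R.nn_integral_fst[symmetric]) (auto intro!: nn_integral_cong nn_integral_cmult)
    also have "\<dots> = (\<integral>\<^sup>+x. pX x \<partial>MX)"
      using AE_prior by (intro nn_integral_cong_AE) auto
    finally show ?thesis by (simp add: nn_integral_pX)
  qed
  moreover have "(\<integral>\<^sup>+z. joint_density p q z * T (snd (fst z)) \<partial>((MX \<Otimes>\<^sub>M MY) \<Otimes>\<^sub>M MR))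
      = (\<integral>\<^sup>+y. pY y * T y \<partial>MY)" if [measurable]: "T \<in> borel_measurable MY" for T
  proof -
    have "(\<integral>\<^sup>+z. p z * T (snd z) \<partial>(MX \<Otimes>\<^sub>M MY)) = (\<integral>\<^sup>+y. (\<integral>\<^sup>+x. p (x, y) * T y \<partial>MX) \<partial>MY)"
      by (subst XY.nn_integral_snd[symmetric]) simp_all
    also have "\<dots> = (\<integral>\<^sup>+y. pY y * T y \<partial>MY)"
      unfolding pY_def by (intro nn_integral_cong nn_integral_multc) simp
    finally show ?thesis
      using nn_integral_joint_density[of "\<lambda>z. T (snd z)"] by simp
  qed
  ultimately show ?thesis
    using infoNCE_le[OF sf joint_density _ _ _ pY _ s K, of "\<lambda>v. pX (fst v) * prior (fst v) (snd v)" \<tau>]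
    by (simp add: kl_term_joint_density)
qed

end

theorem mainTheorem1:
  fixes M :: "'w measure" and MX :: "'x measure" and MY :: "'y measure" and MR :: "'r measure"
    and X :: "'w \<Rightarrow> 'x" and Y :: "'w \<Rightarrow> 'y"
    and p :: "'x \<times> 'y \<Rightarrow> ennreal"
    and q :: "'x \<times> 'y \<Rightarrow> 'r \<Rightarrow> ennreal"
    and prior :: "'x \<Rightarrow> 'r \<Rightarrow> ennreal"
  assumes "prob_space M"
    and "sigma_finite_measure MX" and "sigma_finite_measure MY" and "sigma_finite_measure MR"
    and "X \<in> measurable M MX" and "Y \<in> measurable M MY"
    and "distributed M (MX \<Otimes>\<^sub>M MY) (\<lambda>\<omega>. (X \<omega>, Y \<omega>)) p"
    and "conditional_density (density (MX \<Otimes>\<^sub>M MY) p) MR q"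
    and "conditional_density (distr M MX X) MR prior"
  shows "- enn2ereal (cond_mutual_info MX MY MR (joint_density p q))
           \<ge> - enn2ereal (reg_loss (density (MX \<Otimes>\<^sub>M MY) p) MR q prior)
    \<and> (\<forall>(s :: 'x \<Rightarrow> 'y \<Rightarrow> 'r \<Rightarrow> real) (\<tau> :: real) (K :: nat).
         (\<lambda>((x, y), r). s x y r) \<in> borel_measurable ((MX \<Otimes>\<^sub>M MY) \<Otimes>\<^sub>M MR) \<longrightarrow> \<tau> > 0 \<longrightarrow> K \<ge> 1 \<longrightarrow>
         enn2ereal (mutual_info M MX MY X Y)
           \<ge> - infoNCE_loss (density ((MX \<Otimes>\<^sub>M MY) \<Otimes>\<^sub>M MR) (joint_density p q)) s \<tau> K
             - enn2ereal (reg_loss (density (MX \<Otimes>\<^sub>M MY) p) MR q prior))"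
proof -
  interpret M: prob_space M by fact
  note p = distributed_borel_measurable[OF assms(7)]
  note marginal = M.distr_marginal1[OF assms(2,3,7)]
  have sets_q: "sets (density (MX \<Otimes>\<^sub>M MY) p \<Otimes>\<^sub>M MR) = sets ((MX \<Otimes>\<^sub>M MY) \<Otimes>\<^sub>M MR)"
    by (rule sets_pair_measure_cong) simp_all
  have sets_prior: "sets (distr M MX X \<Otimes>\<^sub>M MR) = sets (MX \<Otimes>\<^sub>M MR)"
    by (rule sets_pair_measure_cong) simp_all
  interpret prob_space "density (MX \<Otimes>\<^sub>M MY) p"
    using M.prob_space_distr[OF distributed_measurable[OF assms(7)]]
    by (simp add: distributed_distr_eq_density[OF assms(7)])
  interpret conditional_prior MX MY MR p q prior
  proof (rule conditional_prior.intro)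
    show "(\<integral>\<^sup>+z. p z \<partial>(MX \<Otimes>\<^sub>M MY)) = 1"
      using emeasure_space_1 p by (simp add: emeasure_density cong: nn_integral_cong)
    have "AE z in MX \<Otimes>\<^sub>M MY. 0 < p z \<longrightarrow> (\<integral>\<^sup>+r. q z r \<partial>MR) = 1"
      using assms(8) by (simp only: conditional_density_def AE_density[OF p])
    then show "AE z in MX \<Otimes>\<^sub>M MY. p z \<noteq> 0 \<longrightarrow> (\<integral>\<^sup>+r. q z r \<partial>MR) = 1"
      by (simp only: zero_less_iff_neq_zero)
    \<comment> \<open>The law of \<open>X\<close> has the \<open>y\<close>-marginal of
      \<open>p\<close> as its density, so a statement almost everywhere under that law concerns the
      points where the marginal is positive.\<close>
    have "AE x in MX. 0 < (\<integral>\<^sup>+y. p (x, y) \<partial>MY) \<longrightarrow> (\<integral>\<^sup>+r. prior x r \<partial>MR) = 1"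
      using assms(9) by (simp only: conditional_density_def distributed_distr_eq_density[OF marginal]
          AE_density[OF distributed_borel_measurable[OF marginal]])
    then show "AE x in MX. (\<integral>\<^sup>+y. p (x, y) \<partial>MY) \<noteq> 0 \<longrightarrow> (\<integral>\<^sup>+r. prior x r \<partial>MR) = 1"
      by (simp only: zero_less_iff_neq_zero)
    show "(\<lambda>(z, r). q z r) \<in> borel_measurable ((MX \<Otimes>\<^sub>M MY) \<Otimes>\<^sub>M MR)"
      using assms(8) by (simp only: conditional_density_def measurable_cong_sets[OF sets_q refl])
    show "(\<lambda>(x, r). prior x r) \<in> borel_measurable (MX \<Otimes>\<^sub>M MR)"
      using assms(9) by (simp only: conditional_density_def measurable_cong_sets[OF sets_prior refl])
  qed (rule assms p)+
  have MI: "mutual_info M MX MY X Y = (\<integral>\<^sup>+z. kl_term (p z) (pX (fst z) * pY (snd z)) \<partial>(MX \<Otimes>\<^sub>M MY))"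
    unfolding pX_def pY_def by (rule M.mutual_info_distributed[OF assms(2,3,7)])
  show ?thesis
  proof (intro conjI allI impI)
    show "- enn2ereal (cond_mutual_info MX MY MR (joint_density p q))
        \<ge> - enn2ereal (reg_loss (density (MX \<Otimes>\<^sub>M MY) p) MR q prior)"
      using cond_mutual_info_le_reg_loss by (simp add: less_eq_ennreal.rep_eq)
  next
    fix s :: "'x \<Rightarrow> 'y \<Rightarrow> 'r \<Rightarrow> real" and \<tau> :: real and K :: nat
    assume "(\<lambda>((x, y), r). s x y r) \<in> borel_measurable ((MX \<Otimes>\<^sub>M MY) \<Otimes>\<^sub>M MR)" "K \<ge> 1"
    \<comment> \<open>For an infinite loss the ceiling ln K makes the difference -\<infinity>; a
      finite loss is simply subtracted.\<close>
    then show "enn2ereal (mutual_info M MX MY X Y)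
        \<ge> - infoNCE_loss (density ((MX \<Otimes>\<^sub>M MY) \<Otimes>\<^sub>M MR) (joint_density p q)) s \<tau> K
          - enn2ereal (reg_loss (density (MX \<Otimes>\<^sub>M MY) p) MR q prior)"
      unfolding MI by (intro ereal_diff_le_of_le_min[OF infoNCE_le_mutual_info])
  qed
qed

end
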